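(* Let $n\ge 1$ and $d,e,m\ge 0$ be integers. Let $\mathbb{C}[c]=\mathbb{C}[c_\gamma : |\gamma|\le m]$ and $S=\mathbb{C}[c,q]$, where $q=(q_\beta:\beta\in M_{0,e})$ is a column vector of further indeterminates, and let $q_0$ be the entry of $q$ indexed by the monomial $1$. Let $J\subset S$ be the ideal generated by the entries of the column vector $P_T\cdot q$. Then the elimination ideal $(J:q_0^\infty)\cap\mathbb{C}[c]$ coincides with the homogeneous prime ideal $\mathcal{I}^n_{d,e,m}\subset\mathbb{C}[c]$ of the Taylor variety $\mathcal{T}^n_{d,e,m}$.
   Context: Work over $\mathbb{C}$ with variables $x=(x_1,\dots,x_n)$; for $\gamma\in\mathbb{N}^n$ write $x^\gamma=x_1^{\gamma_1}\cdots x_n^{\gamma_n}$ and $|\gamma|=\gamma_1+\cdots+\gamma_n$. Let $\mathbb{P}^{\binom{n+m}{n}-1}$ be the projective space with coordinates $c_\gamma$, $|\gamma|\le m$, whose points are nonzero polynomials $T=\sum_{|\gamma|\le m}c_\gamma x^\gamma$ up to scaling. The Taylor variety $\mathcal{T}^n_{d,e,m}\subseteq\mathbb{P}^{\binom{n+m}{n}-1}$ is the Zariski closure of the set of all order-$m$ Taylor polynomials at the origin (Taylor series truncated after total degree $m$) of rational functions $P/Q$ with $P,Q\in\mathbb{C}[x]$, $\deg P\le d$, $\deg Q\le e$, $P(0)=Q(0)=1$. It is irreducible, and $\mathcal{I}^n_{d,e,m}$ denotes its homogeneous prime ideal in $\mathbb{C}[c]$. $M_{a,b}$ denotes the set of monomials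 in $x$ (identified with exponent vectors) of total degree at least $a$ and at most $b$. The Padé matrix $P_T$ is the matrix with rows indexed by $M_{d+1,m}$ and columns indexed by $M_{0,e}$, whose entry in row $x^\alpha$ and column $x^\beta$ is $c_{\alpha-\beta}$ if $\beta\le\alpha$ componentwise and $0$ otherwise. (It represents the linear map sending a polynomial $Q$ of degree $\le e$ to the part of $QT$ supported on the monomials in $M_{d+1,m}$.) The saturation is $(J:q_0^\infty)=\{g\in S: q_0^k g\in J\text{ for some }k\ge 0\}$. *)

theory Defs
  imports
    "HOL-Analysis.Analysis"
    "HOL-Algebra.Ideal"
    "HOL-Library.Poly_Mapping"
begin

section \<open>Polynomials over the complex numbers\<close>

text \<open>
  Variables are elements of an arbitrary type, monomials are finitely supported exponent vectors,
  and addition, multiplication, 0 and 1 are those of \<^theory>\<open>HOL-Library.Poly_Mapping\<close>.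
\<close>

type_synonym 'v monom = "'v \<Rightarrow>\<^sub>0 nat"
type_synonym 'v mpoly = "'v monom \<Rightarrow>\<^sub>0 complex"

definition mdeg :: "'v monom \<Rightarrow> nat" where
  "mdeg \<mu> = (\<Sum>v\<in>Poly_Mapping.keys \<mu>. Poly_Mapping.lookup \<mu> v)"

definition monoms_in :: "'v set \<Rightarrow> 'v monom set" where
  "monoms_in V = {\<mu>. Poly_Mapping.keys \<mu> \<subseteq> V}"

definition mpolys_in :: "'v set \<Rightarrow> 'v mpoly set" where
  "mpolys_in V = {p. Poly_Mapping.keys p \<subseteq> monoms_in V}"

definition degree_le :: "nat \<Rightarrow> 'v mpoly \<Rightarrow> bool" where
  "degree_le k p \<longleftrightarrow> (\<forall>\<mu>\<in>Poly_Mapping.keys p. mdeg \<mu> \<le> k)"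

definition homogeneous :: "'v mpoly \<Rightarrow> bool" where
  "homogeneous p \<longleftrightarrow> (\<exists>k. \<forall>\<mu>\<in>Poly_Mapping.keys p. mdeg \<mu> = k)"

definition Const :: "complex \<Rightarrow> 'v mpoly" where
  "Const a = Poly_Mapping.single 0 a"

definition Var :: "'v \<Rightarrow> 'v mpoly" where
  "Var v = Poly_Mapping.single (Poly_Mapping.single v 1) 1"

definition eval_mpoly :: "'v mpoly \<Rightarrow> ('v \<Rightarrow> complex) \<Rightarrow> complex" where
  "eval_mpoly p a = (\<Sum>\<mu>\<in>Poly_Mapping.keys p.
     Poly_Mapping.lookup p \<mu> * (\<Prod>v\<in>Poly_Mapping.keys \<mu>. a v ^ Poly_Mapping.lookup \<mu> v))"

text \<open>The polynomial ring in the variables \<open>V\<close>, as a ring in the sense of HOL-Algebra.\<close>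

definition mpoly_ring :: "'v set \<Rightarrow> 'v mpoly ring" where
  "mpoly_ring V = \<lparr>carrier = mpolys_in V, mult = (*), one = 1, zero = 0, add = (+)\<rparr>"

lemma mult_mpolys_in:
  assumes "p \<in> mpolys_in V" "q \<in> mpolys_in V"
  shows "p * q \<in> mpolys_in V"
proof -
  have "Poly_Mapping.keys \<mu> \<subseteq> V" if "\<mu> \<in> Poly_Mapping.keys (p * q)" for \<mu>
  proof -
    from that keys_mult[of p q] obtain a b where
      "\<mu> = a + b" "a \<in> Poly_Mapping.keys p" "b \<in> Poly_Mapping.keys q" by blast
    moreover from this assms have "Poly_Mapping.keys a \<subseteq> V" "Poly_Mapping.keys b \<subseteq> V"
      unfolding mpolys_in_def monoms_in_def by blast+
    ultimately show ?thesis using Poly_Mapping.keys_add[of a b] by blast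
  qed
  then show ?thesis by (auto simp: mpolys_in_def monoms_in_def)
qed

lemma mpoly_ring_cring: "cring (mpoly_ring V)"
proof (rule cringI)
  have add: "p + q \<in> mpolys_in V" if "p \<in> mpolys_in V" "q \<in> mpolys_in V" for p q
    using that Poly_Mapping.keys_add[of p q] unfolding mpolys_in_def by blast
  have zero: "0 \<in> mpolys_in V"
    by (simp add: mpolys_in_def)
  have one: "1 \<in> mpolys_in V"
    by (simp add: mpolys_in_def monoms_in_def)
  have inv: "\<exists>y\<in>mpolys_in V. x + y = 0" if "x \<in> mpolys_in V" for x
    using that by (intro bexI[of _ "- x"]) (simp_all add: mpolys_in_def)
  show "abelian_group (mpoly_ring V)"
    by (rule abelian_groupI) (simp_all add: mpoly_ring_def add zero inv ac_simps)
  show "Group.comm_monoid (mpoly_ring V)"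
    by (rule comm_monoidI) (simp_all add: mpoly_ring_def mult_mpolys_in one ac_simps)
qed (simp add: mpoly_ring_def distrib_right)

definition homogeneous_ideal :: "'v set \<Rightarrow> 'v mpoly set \<Rightarrow> bool" where
  "homogeneous_ideal V I \<longleftrightarrow>
     ideal I (mpoly_ring V) \<and> I = Idl\<^bsub>mpoly_ring V\<^esub> {F \<in> I. homogeneous F}"

definition saturation :: "('a, 'b) ring_scheme \<Rightarrow> 'a set \<Rightarrow> 'a \<Rightarrow> 'a set" where
  "saturation R J f = {g \<in> carrier R. \<exists>k::nat. f [^]\<^bsub>R\<^esub> k \<otimes>\<^bsub>R\<^esub> g \<in> J}"


section \<open>Taylor polynomials\<close>

text \<open>
  The variables \<open>x\<^sub>1, \<dots>, x\<^sub>n\<close> are numbered \<open>0, \<dots>, n - 1\<close>. Functions of \<open>x\<close> are taken on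
  \<^typ>\<open>nat \<Rightarrow> complex\<close>; those below only depend on the first \<open>n\<close> coordinates.
\<close>

definition monoms_between :: "nat \<Rightarrow> nat \<Rightarrow> nat \<Rightarrow> nat monom set" where
  "monoms_between n a b = {\<gamma> \<in> monoms_in {..<n}. a \<le> mdeg \<gamma> \<and> mdeg \<gamma> \<le> b}"

lemma finite_monoms_between: "finite (monoms_between n a b)"
proof -
  let ?F = "{f :: nat \<Rightarrow> nat. \<forall>i. (i \<in> {..<n} \<longrightarrow> f i \<in> {..b}) \<and> (i \<notin> {..<n} \<longrightarrow> f i = 0)}"
  have "Poly_Mapping.lookup \<gamma> \<in> ?F" if "\<gamma> \<in> monoms_between n a b" for \<gamma>
  proof -
    have sub: "Poly_Mapping.keys \<gamma> \<subseteq> {..<n}" and deg: "mdeg \<gamma> \<le> b"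
      using that by (simp_all add: monoms_between_def monoms_in_def)
    have "Poly_Mapping.lookup \<gamma> i \<le> b" for i
    proof (cases "i \<in> Poly_Mapping.keys \<gamma>")
      case True
      then have "Poly_Mapping.lookup \<gamma> i \<le> mdeg \<gamma>"
        unfolding mdeg_def by (intro member_le_sum) simp_all
      with deg show ?thesis by simp
    qed (simp add: in_keys_iff)
    moreover have "Poly_Mapping.lookup \<gamma> i = 0" if "i \<notin> {..<n}" for i
      using sub that in_keys_iff[of i \<gamma>] by blast
    ultimately show ?thesis by simp
  qed
  then have "Poly_Mapping.lookup ` monoms_between n a b \<subseteq> ?F"
    by (rule image_subsetI)
  moreover have "finite ?F"
    by (rule finite_set_of_finite_funs) (rule finite_lessThan finite_atMost)+
  ultimately have "finite (Poly_Mapping.lookup ` monoms_between n a b)"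
    by (rule finite_subset)
  then show ?thesis
    by (rule finite_imageD) (rule inj_onI, simp only: poly_mapping_eq_iff)
qed

definition partial_deriv ::
    "nat \<Rightarrow> ((nat \<Rightarrow> complex) \<Rightarrow> complex) \<Rightarrow> (nat \<Rightarrow> complex) \<Rightarrow> complex" where
  "partial_deriv i f = (\<lambda>x. deriv (\<lambda>t. f (x(i := t))) (x i))"

definition multi_deriv ::
    "nat \<Rightarrow> nat monom \<Rightarrow> ((nat \<Rightarrow> complex) \<Rightarrow> complex) \<Rightarrow> (nat \<Rightarrow> complex) \<Rightarrow> complex" where
  "multi_deriv n \<gamma> f = foldr (\<lambda>i. partial_deriv i ^^ Poly_Mapping.lookup \<gamma> i) [0..<n] f"

definition taylor_poly :: "nat \<Rightarrow> nat \<Rightarrow> ((nat \<Rightarrow> complex) \<Rightarrow> complex) \<Rightarrow> nat mpoly" where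
  "taylor_poly n m f = (\<Sum>\<gamma>\<in>monoms_between n 0 m.
     Poly_Mapping.single \<gamma>
       (multi_deriv n \<gamma> f (\<lambda>_. 0) / (\<Prod>i<n. fact (Poly_Mapping.lookup \<gamma> i))))"


section \<open>The projective space of polynomials and the Taylor variety\<close>

text \<open>
  The rings \<open>\<complex>[c]\<close> and \<open>\<complex>[c,q]\<close> share one type of variables, so that \<open>\<complex>[c]\<close> is
  literally a subset of \<open>\<complex>[c,q]\<close>.
\<close>

datatype pade_var = c_var "nat monom" | q_var "nat monom"

definition c_vars :: "nat \<Rightarrow> nat \<Rightarrow> pade_var set" where
  "c_vars n m = c_var ` monoms_between n 0 m"

definition q_vars :: "nat \<Rightarrow> nat \<Rightarrow> pade_var set" where
  "q_vars n e = q_var ` monoms_between n 0 e"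

text \<open>The value of \<open>F \<in> \<complex>[c]\<close> at the coefficient vector of \<open>T\<close>; the variables \<open>q\<close> do not occur.\<close>

definition eval_at_coeffs :: "pade_var mpoly \<Rightarrow> nat mpoly \<Rightarrow> complex" where
  "eval_at_coeffs F T =
     eval_mpoly F (\<lambda>v. case v of c_var \<gamma> \<Rightarrow> Poly_Mapping.lookup T \<gamma> | q_var _ \<Rightarrow> 0)"

text \<open>A point of the projective space is the class of all nonzero multiples of a polynomial.\<close>

definition proj_point :: "nat mpoly \<Rightarrow> nat mpoly set" where
  "proj_point T = {Const a * T | a. a \<noteq> 0}"

definition proj_space :: "nat \<Rightarrow> nat \<Rightarrow> nat mpoly set set" where
  "proj_space n m = proj_point ` {T \<in> mpolys_in {..<n}. degree_le m T \<and> T \<noteq> 0}"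

definition vanishes_at :: "pade_var mpoly \<Rightarrow> nat mpoly set \<Rightarrow> bool" where
  "vanishes_at F p \<longleftrightarrow> (\<forall>T\<in>p. eval_at_coeffs F T = 0)"

definition zariski_closed :: "nat \<Rightarrow> nat \<Rightarrow> nat mpoly set set \<Rightarrow> bool" where
  "zariski_closed n m X \<longleftrightarrow>
     (\<exists>E. E \<subseteq> {F \<in> mpolys_in (c_vars n m). homogeneous F} \<and>
          X = {p \<in> proj_space n m. \<forall>F\<in>E. vanishes_at F p})"

definition vanishing_ideal :: "nat \<Rightarrow> nat \<Rightarrow> nat mpoly set set \<Rightarrow> pade_var mpoly set" where
  "vanishing_ideal n m X = Idl\<^bsub>mpoly_ring (c_vars n m)\<^esub>
     {F \<in> mpolys_in (c_vars n m). homogeneous F \<and> (\<forall>p\<in>X. vanishes_at F p)}"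

definition taylor_polys :: "nat \<Rightarrow> nat \<Rightarrow> nat \<Rightarrow> nat \<Rightarrow> nat mpoly set" where
  "taylor_polys n d e m =
     {taylor_poly n m (\<lambda>x. eval_mpoly P x / eval_mpoly Q x) | P Q.
        P \<in> mpolys_in {..<n} \<and> Q \<in> mpolys_in {..<n} \<and> degree_le d P \<and> degree_le e Q \<and>
        eval_mpoly P (\<lambda>_. 0) = 1 \<and> eval_mpoly Q (\<lambda>_. 0) = 1}"

definition taylor_variety :: "nat \<Rightarrow> nat \<Rightarrow> nat \<Rightarrow> nat \<Rightarrow> nat mpoly set set" where
  "taylor_variety n d e m = zariski_closed n m hull (proj_point ` taylor_polys n d e m)"

definition taylor_ideal :: "nat \<Rightarrow> nat \<Rightarrow> nat \<Rightarrow> nat \<Rightarrow> pade_var mpoly set" where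
  "taylor_ideal n d e m = vanishing_ideal n m (taylor_variety n d e m)"


section \<open>The Pade matrix and its ideal\<close>

text \<open>
  Divisibility of monomials is spelled out componentwise, since \<open>\<le>\<close> on \<^typ>\<open>nat monom\<close> is a
  lexicographic order. The difference \<open>\<alpha> - \<beta>\<close> is componentwise.
\<close>

definition pade_matrix :: "nat monom \<Rightarrow> nat monom \<Rightarrow> pade_var mpoly" where
  "pade_matrix \<alpha> \<beta> =
     (if \<forall>i. Poly_Mapping.lookup \<beta> i \<le> Poly_Mapping.lookup \<alpha> i then Var (c_var (\<alpha> - \<beta>)) else 0)"

definition pade_ring :: "nat \<Rightarrow> nat \<Rightarrow> nat \<Rightarrow> pade_var mpoly ring" where
  "pade_ring n e m = mpoly_ring (c_vars n m \<union> q_vars n e)"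

definition pade_ideal :: "nat \<Rightarrow> nat \<Rightarrow> nat \<Rightarrow> nat \<Rightarrow> pade_var mpoly set" where
  "pade_ideal n d e m = Idl\<^bsub>pade_ring n e m\<^esub>
     ((\<lambda>\<alpha>. \<Sum>\<beta>\<in>monoms_between n 0 e. pade_matrix \<alpha> \<beta> * Var (q_var \<beta>))
        ` monoms_between n (d + 1) m)"

end

theory Submission
  imports Defs "HOL-Computational_Algebra.Polynomial"
begin

text \<open>Modulo the Pade ideal \<open>J\<close>, the row of \<open>\<alpha>\<close> rewrites \<open>q\<^sub>0 c\<^sub>\<alpha>\<close> in terms of \<open>q\<close> and
  coefficients of lower degree. Hence every \<open>F \<in> \<complex>[c]\<close>, multiplied by a power of \<open>q\<^sub>0\<close>, is congruent
  modulo \<open>J\<close> to a polynomial \<open>G\<close> in \<open>q\<close> and the \<open>c\<^sub>\<gamma>\<close> with \<open>|\<gamma>| \<le> d\<close>. These variables are free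
  coordinates: where \<open>q\<^sub>0 c\<^sub>0 \<noteq> 0\<close>, arbitrary values of them extend to a zero of \<open>J\<close> given by a multiple
  of the Taylor polynomial of some \<open>P / Q\<close>; conversely all such multiples are zeros of \<open>J\<close>. Therefore \<open>F\<close> vanishes on
  the cone over the Taylor polynomials iff \<open>G = 0\<close>, iff \<open>F\<close> lies in the saturation; as the
  product of two reductions is a reduction of the product, the ideal is prime.\<close>

abbreviation lookup :: "('a \<Rightarrow>\<^sub>0 'b::zero) \<Rightarrow> 'a \<Rightarrow> 'b" where "lookup \<equiv> Poly_Mapping.lookup"
abbreviation keys :: "('a \<Rightarrow>\<^sub>0 'b::zero) \<Rightarrow> 'a set" where "keys \<equiv> Poly_Mapping.keys"
abbreviation single :: "'a \<Rightarrow> 'b::zero \<Rightarrow> 'a \<Rightarrow>\<^sub>0 'b" where "single \<equiv> Poly_Mapping.single"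

section \<open>Monomials and evaluation\<close>

lemma keys_add_nat: "keys (\<mu> + \<nu> :: 'v monom) = keys \<mu> \<union> keys \<nu>"
  by (auto simp: in_keys_iff lookup_add)

lemma mdeg_superset:
  assumes "finite S" "keys \<mu> \<subseteq> S"
  shows "mdeg \<mu> = (\<Sum>v\<in>S. lookup \<mu> v)"
  unfolding mdeg_def using assms
  by (intro sum.mono_neutral_left) (auto simp: in_keys_iff)

lemma mdeg_add: "mdeg (\<mu> + \<nu>) = mdeg \<mu> + mdeg \<nu>"
  by (simp add: mdeg_superset[of "keys \<mu> \<union> keys \<nu>"] keys_add_nat lookup_add sum.distrib)

lemma mdeg_zero [simp]: "mdeg 0 = 0"
  by (simp add: mdeg_def)

lemma mdeg_single [simp]: "mdeg (single v k) = k"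
  by (simp add: mdeg_def)

lemma mdeg_eq_0_iff [simp]: "mdeg \<mu> = 0 \<longleftrightarrow> \<mu> = 0"
  by (simp add: mdeg_def poly_mapping_eq_iff fun_eq_iff)
    (auto simp: in_keys_iff)

definition mval :: "('v \<Rightarrow> complex) \<Rightarrow> 'v monom \<Rightarrow> complex" where
  "mval a \<mu> = (\<Prod>v\<in>keys \<mu>. a v ^ lookup \<mu> v)"

lemma mval_superset:
  assumes "finite S" "keys \<mu> \<subseteq> S"
  shows "mval a \<mu> = (\<Prod>v\<in>S. a v ^ lookup \<mu> v)"
  unfolding mval_def using assms
  by (intro prod.mono_neutral_left) (auto simp: in_keys_iff)

lemma mval_0 [simp]: "mval a 0 = 1"
  by (simp add: mval_def)

lemma mval_add: "mval a (\<mu> + \<nu>) = mval a \<mu> * mval a \<nu>"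
  by (simp add: mval_superset[of "keys \<mu> \<union> keys \<nu>"] keys_add_nat lookup_add power_add prod.distrib)

lemma mval_mult: "mval (\<lambda>v. a v * b v) \<mu> = mval a \<mu> * mval b \<mu>"
  by (simp add: mval_def power_mult_distrib prod.distrib)

lemma mval_single [simp]: "mval a (single v k) = a v ^ k"
  by (simp add: mval_def)

lemma mval_zero: "mval (\<lambda>_. 0) \<mu> = (if \<mu> = 0 then 1 else 0)"
proof (cases "\<mu> = 0")
  case False
  then have "keys \<mu> \<noteq> {}" by simp
  then obtain v where "v \<in> keys \<mu>" by blast
  with False show ?thesis
    by (auto simp: mval_def in_keys_iff)
qed simp

lemma poly_mapping_sum_single:
  fixes p :: "'a \<Rightarrow>\<^sub>0 'b::comm_monoid_add"
  assumes "finite S" "keys p \<subseteq> S"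
  shows "p = (\<Sum>\<mu>\<in>S. single \<mu> (lookup p \<mu>))"
proof (rule poly_mapping_eqI)
  fix k
  have "lookup p k = (\<Sum>\<mu>\<in>S. if \<mu> = k then lookup p \<mu> else 0)"
    using assms by (auto simp: in_keys_iff)
  also have "\<dots> = lookup (\<Sum>\<mu>\<in>S. single \<mu> (lookup p \<mu>)) k"
    by (simp add: lookup_sum lookup_single when_def)
  finally show "lookup p k = lookup (\<Sum>\<mu>\<in>S. single \<mu> (lookup p \<mu>)) k" .
qed

lemma eval_superset:
  assumes "finite S" "keys p \<subseteq> S"
  shows "eval_mpoly p a = (\<Sum>\<mu>\<in>S. lookup p \<mu> * mval a \<mu>)"
  unfolding eval_mpoly_def mval_def[symmetric] using assms
  by (intro sum.mono_neutral_left) (auto simp: in_keys_iff)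

lemma eval_add: "eval_mpoly (p + q) a = eval_mpoly p a + eval_mpoly q a"
  using Poly_Mapping.keys_add[of p q]
  by (simp add: eval_superset[of "keys p \<union> keys q"] lookup_add distrib_right sum.distrib)

lemma eval_zero [simp]: "eval_mpoly 0 a = 0"
  by (simp add: eval_mpoly_def)

lemma eval_single: "eval_mpoly (single \<mu> c) a = c * mval a \<mu>"
  by (simp add: eval_superset[of "{\<mu>}"])

lemma eval_one [simp]: "eval_mpoly 1 a = 1"
  using eval_single[of 0 1 a] by simp

lemma eval_sum: "eval_mpoly (sum f A) a = (\<Sum>i\<in>A. eval_mpoly (f i) a)"
  by (induction A rule: infinite_finite_induct) (simp_all add: eval_add)

lemma eval_mult: "eval_mpoly (p * q) a = eval_mpoly p a * eval_mpoly q a"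
proof -
  have "p * q = (\<Sum>\<mu>\<in>keys p. single \<mu> (lookup p \<mu>)) * (\<Sum>\<nu>\<in>keys q. single \<nu> (lookup q \<nu>))"
    by (simp flip: poly_mapping_sum_single)
  also have "\<dots> = (\<Sum>\<mu>\<in>keys p. \<Sum>\<nu>\<in>keys q. single (\<mu> + \<nu>) (lookup p \<mu> * lookup q \<nu>))"
    by (simp add: sum_product mult_single)
  finally show ?thesis
    by (simp add: eval_sum eval_single mval_add eval_superset[of "keys p" p] eval_superset[of "keys q" q]
        sum_product ac_simps)
qed

lemma eval_uminus: "eval_mpoly (- p) a = - eval_mpoly p a"
  using eval_add[of p "- p" a] by (simp add: eq_neg_iff_add_eq_0 add.commute)

lemma eval_diff: "eval_mpoly (p - q) a = eval_mpoly p a - eval_mpoly q a"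
  using eval_add[of p "- q" a] by (simp add: eval_uminus)

lemma eval_power: "eval_mpoly (p ^ k) a = eval_mpoly p a ^ k"
  by (induction k) (simp_all add: eval_mult)

lemma eval_Const [simp]: "eval_mpoly (Const c) a = c"
  by (simp add: Const_def eval_single)

lemma eval_Var [simp]: "eval_mpoly (Var v) a = a v"
  by (simp add: Var_def eval_single)

lemma eval_at_zero: "eval_mpoly p (\<lambda>_. 0) = lookup p 0"
proof -
  have "eval_mpoly p (\<lambda>_. 0) = (\<Sum>\<mu>\<in>insert 0 (keys p). lookup p \<mu> * mval (\<lambda>_. 0) \<mu>)"
    by (rule eval_superset) auto
  also have "\<dots> = (\<Sum>\<mu>\<in>insert 0 (keys p). if \<mu> = 0 then lookup p \<mu> else 0)"
    by (rule sum.cong) (simp_all add: mval_zero)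
  also have "\<dots> = lookup p 0"
    by (subst sum.delta) auto
  finally show ?thesis .
qed

lemma eval_cong:
  assumes "p \<in> mpolys_in V" "\<And>v. v \<in> V \<Longrightarrow> a v = b v"
  shows "eval_mpoly p a = eval_mpoly p b"
proof -
  have "a v = b v" if "\<mu> \<in> keys p" "v \<in> keys \<mu>" for \<mu> v
    using assms that by (auto simp: mpolys_in_def monoms_in_def)
  then show ?thesis
    unfolding eval_mpoly_def by simp
qed

section \<open>Subrings of polynomials in given variables\<close>

lemma mpolys_in_add: "p \<in> mpolys_in V \<Longrightarrow> q \<in> mpolys_in V \<Longrightarrow> p + q \<in> mpolys_in V"
  using Poly_Mapping.keys_add[of p q] unfolding mpolys_in_def by blast

lemma mpolys_in_zero [simp]: "0 \<in> mpolys_in V"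
  by (simp add: mpolys_in_def)

lemma mpolys_in_one [simp]: "1 \<in> mpolys_in V"
  by (simp add: mpolys_in_def monoms_in_def)

lemma mpolys_in_uminus: "p \<in> mpolys_in V \<Longrightarrow> - p \<in> mpolys_in V"
  by (simp add: mpolys_in_def)

lemma mpolys_in_diff: "p \<in> mpolys_in V \<Longrightarrow> q \<in> mpolys_in V \<Longrightarrow> p - q \<in> mpolys_in V"
  using mpolys_in_add[of p V "- q"] mpolys_in_uminus[of q V] by simp

lemma mpolys_in_sum: "(\<And>i. i \<in> A \<Longrightarrow> f i \<in> mpolys_in V) \<Longrightarrow> sum f A \<in> mpolys_in V"
  by (induction A rule: infinite_finite_induct) (simp_all add: mpolys_in_add)

lemma mpolys_in_power: "p \<in> mpolys_in V \<Longrightarrow> p ^ k \<in> mpolys_in V"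
  by (induction k) (simp_all add: mult_mpolys_in)

lemma mpolys_in_single: "keys \<mu> \<subseteq> V \<Longrightarrow> single \<mu> c \<in> mpolys_in V"
  by (simp add: mpolys_in_def monoms_in_def)

lemma mpolys_in_Const [simp]: "Const c \<in> mpolys_in V"
  by (simp add: Const_def mpolys_in_single)

lemma mpolys_in_Var: "v \<in> V \<Longrightarrow> Var v \<in> mpolys_in V"
  by (simp add: Var_def mpolys_in_single)

lemma mpolys_in_mono: "V \<subseteq> W \<Longrightarrow> p \<in> mpolys_in V \<Longrightarrow> p \<in> mpolys_in W"
  by (auto simp: mpolys_in_def monoms_in_def)

lemma single_add_one: "single (\<mu> + \<nu>) 1 = (single \<mu> 1 * single \<nu> 1 :: 'v mpoly)"
  by (simp add: mult_single)

lemma single_eq_prod_Var: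
  fixes \<mu> :: "'v monom"
  shows "single \<mu> 1 = (\<Prod>v\<in>keys \<mu>. Var v ^ lookup \<mu> v :: 'v mpoly)"
proof -
  have 1: "single (single v k) 1 = (Var v ^ k :: 'v mpoly)" for v :: 'v and k
  proof (induction k)
    case (Suc k)
    have "single v (Suc k) = single v 1 + single v k"
      by (simp flip: Poly_Mapping.single_add)
    then show ?case
      using Suc by (simp only: single_add_one Var_def power_Suc)
  qed simp
  have 2: "single (sum f A) 1 = (\<Prod>v\<in>A. single (f v) 1 :: 'v mpoly)" if "finite A"
    for f :: "'v \<Rightarrow> 'v monom" and A
    using that by (induction A rule: finite_induct) (simp_all add: single_add_one)
  have "single \<mu> 1 = (single (\<Sum>v\<in>keys \<mu>. single v (lookup \<mu> v)) 1 :: 'v mpoly)"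
    by (simp flip: poly_mapping_sum_single)
  then show ?thesis by (simp add: 1 2)
qed

text \<open>Every polynomial is a sum of constants times products of variables. The rule serves
  properties closed under sums and products, here restriction to a line and reducibility modulo the
  Pade ideal.\<close>

lemma mpolys_in_induct [consumes 1, case_names Const Var add mult]:
  assumes p: "p \<in> mpolys_in V"
    and Const: "\<And>c. P (Const c)"
    and Var: "\<And>v. v \<in> V \<Longrightarrow> P (Var v)"
    and add: "\<And>p q. P p \<Longrightarrow> P q \<Longrightarrow> P (p + q)"
    and mult: "\<And>p q. P p \<Longrightarrow> P q \<Longrightarrow> P (p * q)"
  shows "P p"
proof -
  have one: "P 1" and zero: "P 0"
    using Const[of 1] Const[of 0] by (simp_all add: Const_def)
  have prod: "P (prod f A)" if "\<And>i. i \<in> A \<Longrightarrow> P (f i)" for f :: "'a \<Rightarrow> 'a mpoly" and A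
    using that by (induction A rule: infinite_finite_induct) (auto intro: one mult)
  have sum: "P (sum f A)" if "\<And>i. i \<in> A \<Longrightarrow> P (f i)" for f :: "'a monom \<Rightarrow> 'a mpoly" and A
    using that by (induction A rule: infinite_finite_induct) (auto intro: zero add)
  have power: "P (q ^ k)" if "P q" for q k
    using that by (induction k) (auto intro: one mult)
  have "P (single \<mu> c)" if "keys \<mu> \<subseteq> V" for \<mu> c
  proof -
    have "single \<mu> c = Const c * single \<mu> 1"
      by (simp add: Const_def mult_single)
    moreover have "P (single \<mu> 1)"
      unfolding single_eq_prod_Var using that by (intro prod power Var) auto
    ultimately show ?thesis using Const mult by metis
  qed
  then have "P (\<Sum>\<mu>\<in>keys p. single \<mu> (lookup p \<mu>))"
    using p by (intro sum) (auto simp: mpolys_in_def monoms_in_def)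
  then show ?thesis
    by (simp flip: poly_mapping_sum_single)
qed

section \<open>Polynomials and polynomial functions\<close>

text \<open>Dedekind's argument: distinct monomials are linearly independent, since they are distinct
  characters of the torus.\<close>

lemma monomials_independent:
  assumes "finite S" "\<And>a. (\<forall>v. a v \<noteq> 0) \<Longrightarrow> (\<Sum>\<mu>\<in>S. f \<mu> * mval a \<mu>) = 0" "\<mu> \<in> S"
  shows "f \<mu> = (0::complex)"
  using assms
proof (induction S arbitrary: f \<mu> rule: finite_induct)
  case (insert \<nu> S)
  have S0: "f \<mu> = 0" if \<mu>: "\<mu> \<in> S" for \<mu>
  proof -
    from \<mu> insert.hyps have "\<mu> \<noteq> \<nu>" by blast
    then obtain v where v: "lookup \<mu> v \<noteq> lookup \<nu> v"
      by (meson poly_mapping_eqI)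
    \<comment> \<open>Scaling the coordinate \<open>v\<close>, in which the two exponents differ,
      gives a second relation with coefficients \<open>f \<kappa> * mval b \<kappa>\<close>.
      Subtracting \<open>mval b \<nu>\<close> times the original relation removes the monomial
      \<nu>. The factor 2 stays in the torus and has pairwise distinct powers.\<close>
    define b :: "'a \<Rightarrow> complex" where "b = (\<lambda>w. if w = v then 2 else 1)"
    have b0: "b w \<noteq> 0" for w by (simp add: b_def)
    have mb: "mval b \<kappa> = 2 ^ lookup \<kappa> v" for \<kappa>
    proof -
      have "mval b \<kappa> = (\<Prod>w\<in>insert v (keys \<kappa>). if w = v then 2 ^ lookup \<kappa> w else 1)"
        unfolding mval_superset[OF finite.insertI[OF finite_keys] subset_insertI, of b \<kappa> v]
        by (rule prod.cong) (simp_all add: b_def)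
      also have "\<dots> = 2 ^ lookup \<kappa> v" by (subst prod.delta) auto
      finally show ?thesis .
    qed
    have "f \<mu> * (mval b \<mu> - mval b \<nu>) = 0"
    proof (rule insert.IH[OF _ \<mu>])
      fix a :: "'a \<Rightarrow> complex" assume a: "\<forall>v. a v \<noteq> 0"
      have "(\<Sum>\<kappa>\<in>insert \<nu> S. f \<kappa> * mval (\<lambda>v. b v * a v) \<kappa>) = 0"
        "(\<Sum>\<kappa>\<in>insert \<nu> S. f \<kappa> * mval a \<kappa>) = 0"
        using a b0 by (auto intro!: insert.prems(1))
      moreover have "(\<Sum>\<kappa>\<in>insert \<nu> S. f \<kappa> * (mval b \<kappa> - mval b \<nu>) * mval a \<kappa>)
          = (\<Sum>\<kappa>\<in>insert \<nu> S. f \<kappa> * mval (\<lambda>v. b v * a v) \<kappa>)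
            - mval b \<nu> * (\<Sum>\<kappa>\<in>insert \<nu> S. f \<kappa> * mval a \<kappa>)"
        unfolding sum_distrib_left sum_subtractf[symmetric]
        by (rule sum.cong) (simp_all add: mval_mult algebra_simps)
      ultimately show "(\<Sum>\<kappa>\<in>S. f \<kappa> * (mval b \<kappa> - mval b \<nu>) * mval a \<kappa>) = 0"
        using insert.hyps by simp
    qed
    moreover have "mval b \<mu> \<noteq> mval b \<nu>"
    proof
      assume "mval b \<mu> = mval b \<nu>"
      then have "norm ((2::complex) ^ lookup \<mu> v) = norm ((2::complex) ^ lookup \<nu> v)" by (simp add: mb)
      with v show False by (simp add: norm_power)
    qed
    ultimately show ?thesis by simp
  qed
  \<comment> \<open>Since the other coefficients vanish, the point with all coordinates 1 isolates
    \<open>f \<nu>\<close>.\<close>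
  have "(\<Sum>\<mu>\<in>insert \<nu> S. f \<mu> * mval (\<lambda>_. 1) \<mu>) = 0"
    by (rule insert.prems(1)) simp
  with S0 insert.hyps have "f \<nu> = 0"
    by (simp add: mval_def)
  with S0 insert.prems(2) show ?case by blast
qed simp

text \<open>Only points of the torus need testing, which matters because
  \<open>exists_taylor_point\<close> divides by the values of \<open>c_var 0\<close> and
  \<open>q_var 0\<close>.\<close>

lemma mpoly_eq_0I:
  assumes "\<And>a. (\<forall>v. a v \<noteq> 0) \<Longrightarrow> eval_mpoly p a = 0"
  shows "p = 0"
proof (rule poly_mapping_eqI)
  fix \<mu>
  have "lookup p \<mu> = 0" if "\<mu> \<in> keys p"
    using assms that
    by (intro monomials_independent[of "keys p" "lookup p"]) (simp_all flip: eval_superset)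
  then show "lookup p \<mu> = lookup 0 \<mu>"
    by (auto simp: in_keys_iff)
qed

lemma eval_on_line:
  "\<exists>r. \<forall>t. eval_mpoly p (\<lambda>v. a v + t * b v) = poly r t"
proof -
  have "p \<in> mpolys_in UNIV" by (simp add: mpolys_in_def monoms_in_def)
  then show ?thesis
  proof (induction p rule: mpolys_in_induct)
    case (Const c)
    show ?case by (rule exI[of _ "[:c:]"]) simp
  next
    case (Var v)
    show ?case by (rule exI[of _ "[:a v, b v:]"]) simp
  next
    case (add p q)
    then obtain r s where "\<And>t. eval_mpoly p (\<lambda>v. a v + t * b v) = poly r t"
      "\<And>t. eval_mpoly q (\<lambda>v. a v + t * b v) = poly s t" by blast
    then show ?case by (intro exI[of _ "r + s"]) (simp add: eval_add)
  next
    case (mult p q)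
    then obtain r s where "\<And>t. eval_mpoly p (\<lambda>v. a v + t * b v) = poly r t"
      "\<And>t. eval_mpoly q (\<lambda>v. a v + t * b v) = poly s t" by blast
    then show ?case by (intro exI[of _ "r * s"]) (simp add: eval_mult)
  qed
qed

text \<open>On the line joining a point where p is nonzero to one where q is nonzero, both restrict
  to nonzero univariate polynomials, whose product cannot vanish identically.\<close>

lemma mpoly_no_zero_divisors:
  fixes p q :: "'v mpoly"
  assumes "p * q = 0"
  shows "p = 0 \<or> q = 0"
proof (rule ccontr)
  assume "\<not> ?thesis"
  then obtain a b where ab: "eval_mpoly p a \<noteq> 0" "eval_mpoly q b \<noteq> 0"
    using mpoly_eq_0I by metis
  obtain r s where
    r: "\<And>t. eval_mpoly p (\<lambda>v. a v + t * (b v - a v)) = poly r t" and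
    s: "\<And>t. eval_mpoly q (\<lambda>v. a v + t * (b v - a v)) = poly s t"
    using eval_on_line[of p a "\<lambda>v. b v - a v"] eval_on_line[of q a "\<lambda>v. b v - a v"] by blast
  have "poly r 0 \<noteq> 0" "poly s 1 \<noteq> 0"
    using ab r[of 0] s[of 1] by simp_all
  then have "r * s \<noteq> 0" by auto
  moreover have "poly (r * s) t = 0" for t
    using assms by (simp add: r[symmetric] s[symmetric] eval_mult[symmetric])
  ultimately show False
    using poly_all_0_iff_0 by blast
qed

section \<open>Order at the origin\<close>

lemma lookup_single_mult:
  fixes T :: "'v mpoly"
  shows "lookup (single \<beta> c * T) \<alpha> =
    (if \<forall>i. lookup \<beta> i \<le> lookup \<alpha> i then c * lookup T (\<alpha> - \<beta>) else 0)"
proof -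
  have "single \<beta> c * T = single \<beta> c * (\<Sum>\<nu>\<in>keys T. single \<nu> (lookup T \<nu>))"
    by (simp flip: poly_mapping_sum_single)
  then have eq: "lookup (single \<beta> c * T) \<alpha> = (\<Sum>\<nu>\<in>keys T. if \<beta> + \<nu> = \<alpha> then c * lookup T \<nu> else 0)"
    by (simp add: sum_distrib_left mult_single lookup_sum lookup_single when_def)
  show ?thesis
  proof (cases "\<forall>i. lookup \<beta> i \<le> lookup \<alpha> i")
    case True
    then have "\<beta> + (\<alpha> - \<beta>) = \<alpha>"
      by (intro poly_mapping_eqI) (simp add: lookup_add lookup_minus)
    then have "\<beta> + \<nu> = \<alpha> \<longleftrightarrow> \<nu> = \<alpha> - \<beta>" for \<nu>
      by auto
    then show ?thesis
      using True by (auto simp: eq in_keys_iff)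
  next
    case False
    then have "\<beta> + \<nu> \<noteq> \<alpha>" for \<nu>
      by (auto simp: lookup_add)
    then have "lookup (single \<beta> c * T) \<alpha> = 0" by (simp add: eq)
    with False show ?thesis by (simp only: if_False)
  qed
qed

text \<open>The case distinction has the shape of the entries of \<open>pade_matrix\<close>, so that
  a row evaluated at coefficient vectors matches this sum term by term.\<close>

lemma lookup_mult_sum:
  fixes Q T :: "'v mpoly"
  assumes "finite B" "keys Q \<subseteq> B"
  shows "lookup (Q * T) \<alpha> = (\<Sum>\<beta>\<in>B. if \<forall>i. lookup \<beta> i \<le> lookup \<alpha> i
    then lookup Q \<beta> * lookup T (\<alpha> - \<beta>) else 0)"
proof -
  have "Q * T = (\<Sum>\<beta>\<in>B. single \<beta> (lookup Q \<beta>)) * T"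
    using poly_mapping_sum_single[OF assms] by simp
  then show ?thesis
    by (simp add: sum_distrib_right lookup_sum lookup_single_mult)
qed

text \<open>Membership in the s-th power of the maximal ideal at the origin. A predicate avoids
  assigning an order to 0, which satisfies it for every s.\<close>

definition order_ge :: "nat \<Rightarrow> 'v mpoly \<Rightarrow> bool" where
  "order_ge s p \<longleftrightarrow> (\<forall>\<mu>\<in>keys p. s \<le> mdeg \<mu>)"

lemma order_ge_lookup: "order_ge s p \<longleftrightarrow> (\<forall>\<mu>. mdeg \<mu> < s \<longrightarrow> lookup p \<mu> = 0)"
  by (auto simp: order_ge_def in_keys_iff not_le[symmetric])

lemma order_ge_1_iff: "order_ge (Suc 0) p \<longleftrightarrow> lookup p 0 = 0"
  by (auto simp: order_ge_lookup)

lemma order_ge_mono: "order_ge t p \<Longrightarrow> s \<le> t \<Longrightarrow> order_ge s p"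
  by (auto simp: order_ge_def)

lemma order_ge_add: "order_ge s p \<Longrightarrow> order_ge s q \<Longrightarrow> order_ge s (p + q)"
  by (simp add: order_ge_lookup lookup_add)

lemma order_ge_diff: "order_ge s p \<Longrightarrow> order_ge s q \<Longrightarrow> order_ge s (p - q)"
  by (simp add: order_ge_lookup lookup_minus)

lemma order_ge_mult: "order_ge s p \<Longrightarrow> order_ge t q \<Longrightarrow> order_ge (s + t) (p * q)"
  using keys_mult[of p q] by (fastforce simp: order_ge_def mdeg_add intro: add_mono)

lemma order_ge_0 [simp]: "order_ge 0 p"
  by (simp add: order_ge_def)

lemma order_ge_mult_left: "order_ge s q \<Longrightarrow> order_ge s (p * q)"
  using order_ge_mult[of 0 p s q] by simp

lemma order_ge_power: "order_ge (Suc 0) p \<Longrightarrow> order_ge k (p ^ k)"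
  by (induction k) (simp_all, metis order_ge_mult plus_1_eq_Suc One_nat_def)

text \<open>A polynomial with constant term 1 is a unit modulo every power of the maximal ideal at
  the origin: the geometric series in \<open>1 - Q\<close> inverts it up to
  \<open>(1 - Q) ^ Suc s\<close>, so X is recovered from \<open>Q * X\<close> up to order s.\<close>

lemma order_ge_cancel:
  fixes Q X :: "'v mpoly"
  assumes "order_ge s (Q * X)" "lookup Q 0 = 1"
  shows "order_ge s X"
proof -
  have "order_ge (Suc 0) (1 - Q)"
    using assms(2) by (simp add: order_ge_1_iff lookup_minus)
  then have N: "order_ge s ((1 - Q) ^ Suc s)"
    using order_ge_power order_ge_mono by (metis le_SucI order_refl)
  have "Q * (\<Sum>i\<le>s. (1 - Q) ^ i) = 1 - (1 - Q) ^ Suc s"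
    using sum_gp_basic[of "1 - Q" s] by simp
  moreover have "(\<Sum>i\<le>s. (1 - Q) ^ i) * (Q * X) = (Q * (\<Sum>i\<le>s. (1 - Q) ^ i)) * X"
    by (simp only: mult_ac)
  ultimately have "X = (\<Sum>i\<le>s. (1 - Q) ^ i) * (Q * X) + X * (1 - Q) ^ Suc s"
    by (simp only: left_diff_distrib mult_1 mult.commute[of X] diff_add_cancel)
  moreover have "order_ge s \<dots>"
    by (intro order_ge_add order_ge_mult_left assms(1) N)
  ultimately show ?thesis by simp
qed

section \<open>Truncation and truncated quotients of power series\<close>

definition mpoly_of :: "nat \<Rightarrow> nat \<Rightarrow> (nat monom \<Rightarrow> complex) \<Rightarrow> nat mpoly" where
  "mpoly_of n b f = (\<Sum>\<gamma>\<in>monoms_between n 0 b. single \<gamma> (f \<gamma>))"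

lemma lookup_mpoly_of: "lookup (mpoly_of n b f) \<gamma> = (if \<gamma> \<in> monoms_between n 0 b then f \<gamma> else 0)"
  by (simp add: mpoly_of_def lookup_sum lookup_single when_def finite_monoms_between)

lemma keys_mpoly_of: "keys (mpoly_of n b f) \<subseteq> monoms_between n 0 b"
  by (auto simp: in_keys_iff lookup_mpoly_of split: if_splits)

lemma mpoly_of_lookup: "keys T \<subseteq> monoms_between n 0 b \<Longrightarrow> mpoly_of n b (lookup T) = T"
  unfolding mpoly_of_def using poly_mapping_sum_single[OF finite_monoms_between] by metis

lemma order_ge_truncate:
  assumes "p \<in> mpolys_in {..<n}"
  shows "order_ge (Suc b) (p - mpoly_of n b (lookup p))"
  unfolding order_ge_lookup
proof (intro allI impI)
  fix \<gamma> :: "nat monom" assume "mdeg \<gamma> < Suc b"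
  then show "lookup (p - mpoly_of n b (lookup p)) \<gamma> = 0"
    using assms by (cases "\<gamma> \<in> keys p")
      (auto simp: lookup_minus lookup_mpoly_of monoms_between_def mpolys_in_def in_keys_iff)
qed

lemma keys_subset_monoms_between_iff:
  "keys T \<subseteq> monoms_between n 0 b \<longleftrightarrow> T \<in> mpolys_in {..<n} \<and> degree_le b T"
  by (auto simp: monoms_between_def mpolys_in_def degree_le_def)

text \<open>Multiplying P by the geometric series for 1/Q leaves the error
  \<open>P * (1 - Q) ^ Suc m\<close>, and truncation after degree m changes only higher terms. This
  constructs the Taylor polynomial of P/Q without derivatives.\<close>

lemma exists_series_quotient:
  fixes P Q :: "nat mpoly"
  assumes P: "P \<in> mpolys_in {..<n}" and Q: "Q \<in> mpolys_in {..<n}" "lookup Q 0 = 1"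
  shows "\<exists>T. keys T \<subseteq> monoms_between n 0 m \<and> order_ge (Suc m) (P - Q * T)"
proof -
  define T0 where "T0 = P * (\<Sum>i\<le>m. (1 - Q) ^ i)"
  define T where "T = mpoly_of n m (lookup T0)"
  have T0: "T0 \<in> mpolys_in {..<n}"
    unfolding T0_def
    by (intro mult_mpolys_in mpolys_in_sum mpolys_in_power mpolys_in_diff mpolys_in_one P Q)
  then have "order_ge (Suc m) (T0 - T)"
    unfolding T_def by (rule order_ge_truncate)
  moreover have "order_ge (Suc m) (P - Q * T0)"
  proof -
    have "order_ge (Suc 0) (1 - Q)"
      using Q(2) by (simp add: order_ge_1_iff lookup_minus)
    then have "order_ge (Suc m) (P * (1 - Q) ^ Suc m)"
      by (intro order_ge_mult_left order_ge_power)
    moreover have "P - Q * T0 = P * (1 - Q) ^ Suc m"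
    proof -
      have "Q * T0 = P * (Q * (\<Sum>i\<le>m. (1 - Q) ^ i))"
        by (simp add: T0_def mult_ac)
      also have "Q * (\<Sum>i\<le>m. (1 - Q) ^ i) = 1 - (1 - Q) ^ Suc m"
        using sum_gp_basic[of "1 - Q" m] by simp
      finally show ?thesis by (simp add: right_diff_distrib)
    qed
    ultimately show ?thesis by simp
  qed
  ultimately have "order_ge (Suc m) ((P - Q * T0) + Q * (T0 - T))"
    by (intro order_ge_add order_ge_mult_left)
  then have "order_ge (Suc m) (P - Q * T)"
    by (simp add: algebra_simps)
  moreover have "keys T \<subseteq> monoms_between n 0 m"
    unfolding T_def by (rule keys_mpoly_of)
  ultimately show ?thesis by blast
qed

section \<open>Partial derivatives of rational functions\<close>

text \<open>The subtraction of exponents is truncated. If the variable i does not occur in \<mu>,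
  the resulting monomial is wrong but carries the coefficient 0.\<close>

definition pd :: "'v \<Rightarrow> 'v mpoly \<Rightarrow> 'v mpoly" where
  "pd i p = (\<Sum>\<mu>\<in>keys p. single (\<mu> - single i 1) (of_nat (lookup \<mu> i) * lookup p \<mu>))"

lemma lookup_pd: "lookup (pd i p) \<nu> = of_nat (Suc (lookup \<nu> i)) * lookup p (\<nu> + single i 1)"
proof -
  have "lookup (pd i p) \<nu> =
      (\<Sum>\<mu>\<in>keys p. if \<mu> - single i 1 = \<nu> then of_nat (lookup \<mu> i) * lookup p \<mu> else 0)"
    by (simp add: pd_def lookup_sum lookup_single when_def)
  also have "\<dots> = (\<Sum>\<mu>\<in>keys p. if \<mu> = \<nu> + single i 1 then of_nat (lookup \<mu> i) * lookup p \<mu> else 0)"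
  proof (rule sum.cong)
    fix \<mu> assume "\<mu> \<in> keys p"
    show "(if \<mu> - single i 1 = \<nu> then of_nat (lookup \<mu> i) * lookup p \<mu> else 0) =
      (if \<mu> = \<nu> + single i 1 then of_nat (lookup \<mu> i) * lookup p \<mu> else 0)"
    proof (cases "lookup \<mu> i = 0")
      case False
      then have "\<mu> - single i 1 + single i 1 = \<mu>"
        by (intro poly_mapping_eqI) (auto simp: lookup_add lookup_minus lookup_single when_def)
      then have "\<mu> - single i 1 = \<nu> \<longleftrightarrow> \<mu> = \<nu> + single i 1"
        by auto
      then show ?thesis by simp
    qed simp
  qed simp
  also have "\<dots> = of_nat (Suc (lookup \<nu> i)) * lookup p (\<nu> + single i 1)"
    by (auto simp: in_keys_iff lookup_add)
  finally show ?thesis .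
qed

lemma mval_fun_upd:
  assumes "finite S" "keys \<mu> \<subseteq> S" "i \<in> S"
  shows "mval (x(i := t)) \<mu> = t ^ lookup \<mu> i * (\<Prod>v\<in>S - {i}. x v ^ lookup \<mu> v)"
  unfolding mval_superset[OF assms(1,2)] prod.remove[OF assms(1,3)] by simp

lemma eval_pd:
  "((\<lambda>t. eval_mpoly p (x(i := t))) has_field_derivative eval_mpoly (pd i p) (x(i := z))) (at z)"
proof -
  have "((\<lambda>t. mval (x(i := t)) \<mu>) has_field_derivative
      of_nat (lookup \<mu> i) * mval (x(i := z)) (\<mu> - single i 1)) (at z)" for \<mu>
  proof -
    let ?S = "insert i (keys \<mu>)"
    have sub: "keys (\<mu> - single i 1) \<subseteq> ?S"
      by (auto simp: in_keys_iff lookup_minus)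
    have "mval (x(i := t)) \<mu> = t ^ lookup \<mu> i * (\<Prod>v\<in>?S - {i}. x v ^ lookup \<mu> v)" for t
      by (rule mval_fun_upd) auto
    moreover have "mval (x(i := z)) (\<mu> - single i 1) =
        z ^ (lookup \<mu> i - 1) * (\<Prod>v\<in>?S - {i}. x v ^ lookup \<mu> v)"
      by (subst mval_fun_upd[OF _ sub]) (auto simp: lookup_minus lookup_single when_def intro!: prod.cong)
    ultimately show ?thesis
      by (auto intro!: derivative_eq_intros)
  qed
  note D = this
  have "((\<lambda>t. \<Sum>\<mu>\<in>keys p. lookup p \<mu> * mval (x(i := t)) \<mu>) has_field_derivative
      (\<Sum>\<mu>\<in>keys p. lookup p \<mu> * (of_nat (lookup \<mu> i) * mval (x(i := z)) (\<mu> - single i 1)))) (at z)"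
    by (intro DERIV_sum DERIV_cmult D)
  then show ?thesis
    by (simp add: pd_def eval_sum eval_single eval_superset[of "keys p" p] mult_ac)
qed

lemma order_ge_pd: "order_ge (Suc s) p \<Longrightarrow> order_ge s (pd i p)"
  by (simp add: order_ge_lookup lookup_pd mdeg_add)

text \<open>This is the quotient rule with the common powers of Q cancelled. The formula for f where
  Q is nonzero suffices, because that set is open along the coordinate line.\<close>

lemma partial_deriv_quotient:
  assumes f: "\<And>x. eval_mpoly Q x \<noteq> 0 \<Longrightarrow> f x = eval_mpoly T x + eval_mpoly R x / eval_mpoly Q x ^ k"
    and x: "eval_mpoly Q x \<noteq> 0"
  shows "partial_deriv i f x = eval_mpoly (pd i T) x +
    eval_mpoly (pd i R * Q - Const (of_nat k) * R * pd i Q) x / eval_mpoly Q x ^ Suc k"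
proof -
  let ?e = "\<lambda>p t. eval_mpoly p (x(i := t))"
  have cont: "continuous_on UNIV (?e Q)"
    by (intro continuous_at_imp_continuous_on ballI DERIV_isCont[OF eval_pd])
  have "open {t. ?e Q t \<noteq> 0}"
    using cont by (intro open_Collect_neq) auto
  moreover have "x i \<in> {t. ?e Q t \<noteq> 0}"
    using x by simp
  moreover have "((\<lambda>t. ?e T t + ?e R t / ?e Q t ^ k) has_field_derivative
     eval_mpoly (pd i T) x +
      eval_mpoly (pd i R * Q - Const (of_nat k) * R * pd i Q) x / eval_mpoly Q x ^ Suc k) (at (x i))"
  proof -
    \<comment> \<open>For \<open>k = 0\<close> the truncated exponent \<open>k - Suc 0\<close> is
      harmless, since its term has the factor \<open>of_nat k\<close>.\<close>
    have quot: "(r' * q ^ k - r * (of_nat k * (q' * q ^ (k - Suc 0)))) / (q ^ k * q ^ k)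
        = (r' * q - of_nat k * r * q') / q ^ Suc k" if "q \<noteq> 0" for q q' r r' :: complex
      using that by (cases k) (simp_all add: field_simps)
    have D: "(?e p has_field_derivative eval_mpoly (pd i p) x) (at (x i))" for p
      using eval_pd[of p x i "x i"] by simp
    have "((\<lambda>t. ?e T t + ?e R t / ?e Q t ^ k) has_field_derivative eval_mpoly (pd i T) x +
      (eval_mpoly (pd i R) x * ?e Q (x i) ^ k
        - ?e R (x i) * (of_nat k * (eval_mpoly (pd i Q) x * ?e Q (x i) ^ (k - Suc 0))))
      / (?e Q (x i) ^ k * ?e Q (x i) ^ k)) (at (x i))"
      using x by (intro DERIV_add DERIV_divide DERIV_power D) simp_all
    then show ?thesis
      using quot[OF x] by (simp add: eval_diff eval_mult)
  qed
  ultimately have "((\<lambda>t. f (x(i := t))) has_field_derivative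
     eval_mpoly (pd i T) x +
      eval_mpoly (pd i R * Q - Const (of_nat k) * R * pd i Q) x / eval_mpoly Q x ^ Suc k) (at (x i))"
    by (elim has_field_derivative_transform_within_open) (auto simp: f)
  then show ?thesis
    unfolding partial_deriv_def by (rule DERIV_imp_deriv)
qed

section \<open>Taylor polynomials of rational functions\<close>

text \<open>R and k stay existential because each differentiation changes both. Nothing is asked
  where Q vanishes, so the value of a division by zero does not matter.\<close>

definition close_to :: "nat \<Rightarrow> 'v mpoly \<Rightarrow> 'v mpoly \<Rightarrow> (('v \<Rightarrow> complex) \<Rightarrow> complex) \<Rightarrow> bool" where
  "close_to s Q T f \<longleftrightarrow> (\<exists>R k. order_ge s R \<and>
    (\<forall>x. eval_mpoly Q x \<noteq> 0 \<longrightarrow> f x = eval_mpoly T x + eval_mpoly R x / eval_mpoly Q x ^ k))"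

lemma close_to_partial_deriv:
  assumes "close_to (Suc s) Q T f"
  shows "close_to s Q (pd i T) (partial_deriv i f)"
proof -
  obtain R k where R: "order_ge (Suc s) R"
    and f: "\<And>x. eval_mpoly Q x \<noteq> 0 \<Longrightarrow> f x = eval_mpoly T x + eval_mpoly R x / eval_mpoly Q x ^ k"
    using assms unfolding close_to_def by blast
  have "order_ge s R"
    using R by (rule order_ge_mono) simp
  then have "order_ge s (Q * pd i R - (Const (of_nat k) * pd i Q) * R)"
    by (intro order_ge_diff order_ge_mult_left order_ge_pd R)
  then have "order_ge s (pd i R * Q - Const (of_nat k) * R * pd i Q)"
    by (simp only: mult_ac)
  with partial_deriv_quotient[OF f] show ?thesis
    unfolding close_to_def by blast
qed

lemma close_to_partial_deriv_funpow:
  "close_to (s + j) Q T f \<Longrightarrow> close_to s Q ((pd i ^^ j) T) ((partial_deriv i ^^ j) f)"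
proof (induction j arbitrary: s)
  case (Suc j)
  then have "close_to (Suc s) Q ((pd i ^^ j) T) ((partial_deriv i ^^ j) f)" by simp
  then show ?case by (simp add: close_to_partial_deriv)
qed simp

lemma close_to_foldr:
  "close_to (s + (\<Sum>i\<leftarrow>is. \<gamma> i)) Q T f \<Longrightarrow>
    close_to s Q (foldr (\<lambda>i. pd i ^^ \<gamma> i) is T) (foldr (\<lambda>i. partial_deriv i ^^ \<gamma> i) is f)"
proof (induction "is" arbitrary: s)
  case (Cons i "is")
  then show ?case
    by (simp add: close_to_partial_deriv_funpow add.assoc)
qed simp

lemma lookup_pd_funpow:
  "lookup \<nu> i = 0 \<Longrightarrow> lookup ((pd i ^^ j) T) \<nu> = fact j * lookup T (\<nu> + single i j)"
proof -
  \<comment> \<open>The factorial on the left allows an arbitrary exponent of i in \<nu>. The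
    induction needs this, since each derivative shifts that exponent by one.\<close>
  have "lookup ((pd i ^^ j) T) \<nu> * fact (lookup \<nu> i) =
      fact (lookup \<nu> i + j) * lookup T (\<nu> + single i j)" for \<nu>
  proof (induction j arbitrary: \<nu>)
    case (Suc j)
    have "\<nu> + single i 1 + single i j = \<nu> + single i (Suc j)"
      by (simp add: add.assoc flip: Poly_Mapping.single_add)
    with Suc[of "\<nu> + single i 1"] show ?case
      by (simp add: lookup_pd lookup_add algebra_simps)
  qed simp
  then show "lookup \<nu> i = 0 \<Longrightarrow> ?thesis"
    by (metis add_0 fact_0 mult.right_neutral)
qed

lemma lookup_pd_foldr:
  assumes "distinct is" "\<And>i. i \<in> set is \<Longrightarrow> lookup \<nu> i = 0"
  shows "lookup (foldr (\<lambda>i. pd i ^^ \<gamma> i) is T) \<nu> =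
    (\<Prod>i\<in>set is. fact (\<gamma> i)) * lookup T (\<nu> + (\<Sum>i\<in>set is. single i (\<gamma> i)))"
  using assms
proof (induction "is" arbitrary: \<nu>)
  case (Cons i "is")
  have "lookup (\<nu> + single i (\<gamma> i)) k = 0" if "k \<in> set is" for k
    using Cons.prems that by (auto simp: lookup_add lookup_single when_def)
  then show ?case
    using Cons by (simp add: lookup_pd_funpow add.assoc)
qed simp

lemma multi_deriv_close_to:
  fixes T :: "nat mpoly"
  assumes f: "close_to (Suc m) Q T f" and Q: "lookup Q 0 \<noteq> 0" and \<gamma>: "\<gamma> \<in> monoms_between n 0 m"
  shows "multi_deriv n \<gamma> f (\<lambda>_. 0) = (\<Prod>i<n. fact (lookup \<gamma> i)) * lookup T \<gamma>"
proof -
  have keys: "keys \<gamma> \<subseteq> {..<n}" and deg: "mdeg \<gamma> \<le> m"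
    using \<gamma> by (simp_all add: monoms_between_def monoms_in_def)
  have "(\<Sum>i\<leftarrow>[0..<n]. lookup \<gamma> i) = mdeg \<gamma>"
    using keys by (simp add: mdeg_superset[of "{..<n}"] interv_sum_list_conv_sum_set_nat atLeast0LessThan)
  \<comment> \<open>The agreement has order m + 1 and at most m derivatives are taken, so order at
    least 1 remains and the remainder still vanishes at 0.\<close>
  then obtain s where s: "Suc m = Suc s + (\<Sum>i\<leftarrow>[0..<n]. lookup \<gamma> i)"
    using deg by (metis add_Suc le_add_diff_inverse2)
  have "close_to (Suc s) Q (foldr (\<lambda>i. pd i ^^ lookup \<gamma> i) [0..<n] T) (multi_deriv n \<gamma> f)"
    unfolding multi_deriv_def using f by (intro close_to_foldr) (simp add: s)
  then obtain R k where R: "order_ge (Suc s) R" and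
    eq: "\<And>x. eval_mpoly Q x \<noteq> 0 \<Longrightarrow> multi_deriv n \<gamma> f x =
      eval_mpoly (foldr (\<lambda>i. pd i ^^ lookup \<gamma> i) [0..<n] T) x + eval_mpoly R x / eval_mpoly Q x ^ k"
    unfolding close_to_def by blast
  have "lookup R 0 = 0"
    using R by (simp add: order_ge_lookup)
  then have "multi_deriv n \<gamma> f (\<lambda>_. 0) = lookup (foldr (\<lambda>i. pd i ^^ lookup \<gamma> i) [0..<n] T) 0"
    using Q by (simp add: eq eval_at_zero)
  also have "\<dots> = (\<Prod>i<n. fact (lookup \<gamma> i)) * lookup T (\<Sum>i<n. single i (lookup \<gamma> i))"
    by (simp add: lookup_pd_foldr atLeast0LessThan)
  also have "(\<Sum>i<n. single i (lookup \<gamma> i)) = \<gamma>"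
    using keys by (simp flip: poly_mapping_sum_single)
  finally show ?thesis .
qed

text \<open>If \<open>P - Q T\<close> has order greater than \<open>m\<close>, then \<open>P / Q = T + (P - Q T) / Q\<close>, and
  differentiating a fraction with denominator a power of \<open>Q\<close> lowers the order of the numerator by
  at most one. So the remainder does not contribute to the derivatives of order at most \<open>m\<close> at 0.\<close>

lemma taylor_poly_quotient:
  assumes T: "keys T \<subseteq> monoms_between n 0 m"
    and R: "order_ge (Suc m) (P - Q * T)" and Q: "lookup Q 0 \<noteq> 0"
  shows "taylor_poly n m (\<lambda>x. eval_mpoly P x / eval_mpoly Q x) = T"
proof -
  let ?f = "\<lambda>x. eval_mpoly P x / eval_mpoly Q x"
  have "?f x = eval_mpoly T x + eval_mpoly (P - Q * T) x / eval_mpoly Q x ^ 1"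
    if "eval_mpoly Q x \<noteq> 0" for x
    using that by (simp add: eval_diff eval_mult field_simps)
  with R have "close_to (Suc m) Q T ?f"
    unfolding close_to_def by blast
  then have "taylor_poly n m ?f = mpoly_of n m (lookup T)"
    unfolding taylor_poly_def mpoly_of_def
    by (intro sum.cong refl) (simp add: multi_deriv_close_to[OF _ Q])
  with T show ?thesis by (simp add: mpoly_of_lookup)
qed

section \<open>The ideal of the cone over the Taylor polynomials\<close>

text \<open>A truncated quotient always exists, and \<open>taylor_poly_quotient\<close> identifies
  any solution of the congruence with the Taylor polynomial. From here on derivatives are replaced
  by the congruence of P and Q T up to degree m.\<close>

lemma taylor_polys_iff:
  "T \<in> taylor_polys n d e m \<longleftrightarrow> keys T \<subseteq> monoms_between n 0 m \<and>
    (\<exists>P Q. keys P \<subseteq> monoms_between n 0 d \<and> keys Q \<subseteq> monoms_between n 0 e \<and>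
      lookup P 0 = 1 \<and> lookup Q 0 = 1 \<and> order_ge (Suc m) (P - Q * T))" (is "?L \<longleftrightarrow> ?R")
proof
  assume ?L
  then obtain P Q where T: "T = taylor_poly n m (\<lambda>x. eval_mpoly P x / eval_mpoly Q x)"
    and PQ: "P \<in> mpolys_in {..<n}" "Q \<in> mpolys_in {..<n}" "degree_le d P" "degree_le e Q"
      "lookup P 0 = 1" "lookup Q 0 = 1"
    by (auto simp: taylor_polys_def eval_at_zero)
  obtain T' where T': "keys T' \<subseteq> monoms_between n 0 m" "order_ge (Suc m) (P - Q * T')"
    using exists_series_quotient[OF PQ(1,2,6)] by blast
  then have "T' = T"
    using taylor_poly_quotient[OF T'] PQ(6) by (simp add: T)
  with T' PQ show ?R
    unfolding keys_subset_monoms_between_iff by blast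
next
  assume ?R
  then obtain P Q where T: "keys T \<subseteq> monoms_between n 0 m"
    and PQ: "keys P \<subseteq> monoms_between n 0 d" "keys Q \<subseteq> monoms_between n 0 e"
      "lookup P 0 = 1" "lookup Q 0 = 1" "order_ge (Suc m) (P - Q * T)"
    by blast
  from taylor_poly_quotient[OF T PQ(5)] PQ(4)
  have "T = taylor_poly n m (\<lambda>x. eval_mpoly P x / eval_mpoly Q x)" by simp
  with PQ show ?L
    unfolding keys_subset_monoms_between_iff taylor_polys_def eval_at_zero by blast
qed

lemma lookup_taylor_poly_0: "T \<in> taylor_polys n d e m \<Longrightarrow> lookup T 0 = 1"
proof -
  assume "T \<in> taylor_polys n d e m"
  then obtain P Q where "lookup P 0 = 1" "lookup Q 0 = 1" "order_ge (Suc m) (P - Q * T)"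
    unfolding taylor_polys_iff by blast
  then have "1 - lookup (Q * T) 0 = 0" "lookup Q 0 = 1"
    by (auto simp: order_ge_lookup lookup_minus)
  moreover have "lookup (Q * T) 0 = lookup Q 0 * lookup T 0"
    using eval_mult[of Q T "\<lambda>_. 0"] by (simp add: eval_at_zero)
  ultimately show ?thesis by simp
qed

lemma lookup_Const_mult: "lookup (Const a * p) \<mu> = a * lookup p \<mu>"
  by (simp add: Const_def lookup_single_mult)

lemma keys_Const_mult: "keys (Const a * p) \<subseteq> keys p"
  by (auto simp: in_keys_iff lookup_Const_mult)

section \<open>Ideals of polynomial rings and homogeneous components\<close>

lemma mpoly_ring_simps [simp]:
  "carrier (mpoly_ring V) = mpolys_in V"
  "p \<otimes>\<^bsub>mpoly_ring V\<^esub> q = p * q"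
  "p \<oplus>\<^bsub>mpoly_ring V\<^esub> q = p + q"
  "\<one>\<^bsub>mpoly_ring V\<^esub> = 1"
  "\<zero>\<^bsub>mpoly_ring V\<^esub> = 0"
  by (simp_all add: mpoly_ring_def)

lemma mpoly_ring_ring: "ring (mpoly_ring V)"
  by (rule cring.axioms(1)[OF mpoly_ring_cring])

lemma mpoly_ring_pow: "p [^]\<^bsub>mpoly_ring V\<^esub> (k::nat) = p ^ k"
  by (induction k) (simp_all add: nat_pow_def mult.commute)

text \<open>Closure under negation comes from multiplication by the constant -1, so only sums and
  multiples have to be checked.\<close>

lemma ideal_mpolyI:
  assumes "I \<subseteq> mpolys_in V" "0 \<in> I" "\<And>p q. p \<in> I \<Longrightarrow> q \<in> I \<Longrightarrow> p + q \<in> I"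
    and mult: "\<And>p q. p \<in> mpolys_in V \<Longrightarrow> q \<in> I \<Longrightarrow> p * q \<in> I"
  shows "ideal I (mpoly_ring V)"
proof (rule idealI[OF mpoly_ring_ring])
  interpret ring "mpoly_ring V" by (rule mpoly_ring_ring)
  show "subgroup I (add_monoid (mpoly_ring V))"
  proof (rule add.subgroupI)
    fix p assume p: "p \<in> I"
    then have "\<ominus>\<^bsub>mpoly_ring V\<^esub> p = - p"
      using assms(1) by (intro minus_equality) (auto intro: mpolys_in_uminus)
    moreover have "Const (-1) * p \<in> I"
      by (intro mult p) simp
    moreover have "Const (-1) * p = - p"
      by (rule poly_mapping_eqI) (simp add: lookup_Const_mult)
    ultimately show "\<ominus>\<^bsub>mpoly_ring V\<^esub> p \<in> I" by simp
  qed (use assms in auto)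
next
  fix p q assume "q \<in> I" "p \<in> carrier (mpoly_ring V)"
  then show "p \<otimes>\<^bsub>mpoly_ring V\<^esub> q \<in> I" "q \<otimes>\<^bsub>mpoly_ring V\<^esub> p \<in> I"
    using mult[of p q] by (simp_all add: mult.commute[of q p])
qed

lemma ideal_mpolyD:
  assumes "ideal I (mpoly_ring V)"
  shows "I \<subseteq> mpolys_in V" "0 \<in> I" "p \<in> I \<Longrightarrow> q \<in> I \<Longrightarrow> p + q \<in> I"
    "p \<in> mpolys_in V \<Longrightarrow> q \<in> I \<Longrightarrow> p * q \<in> I"
    "p \<in> I \<Longrightarrow> - p \<in> I" "p \<in> I \<Longrightarrow> q \<in> I \<Longrightarrow> p - q \<in> I"
    "(\<And>i. i \<in> A \<Longrightarrow> f i \<in> I) \<Longrightarrow> sum f A \<in> I"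
proof -
  interpret ideal I "mpoly_ring V" by fact
  show sub: "I \<subseteq> mpolys_in V" and zero: "0 \<in> I"
    using a_subset additive_subgroup.zero_closed[OF is_additive_subgroup] by simp_all
  show add: "p \<in> I \<Longrightarrow> q \<in> I \<Longrightarrow> p + q \<in> I" for p q
    using additive_subgroup.a_closed[OF is_additive_subgroup, of p q] by simp
  show mult: "p \<in> mpolys_in V \<Longrightarrow> q \<in> I \<Longrightarrow> p * q \<in> I" for p q
    using I_l_closed[of q p] by simp
  show uminus: "p \<in> I \<Longrightarrow> - p \<in> I" for p
    using mult[of "- 1" p] by (simp add: mpolys_in_uminus)
  show "p \<in> I \<Longrightarrow> q \<in> I \<Longrightarrow> p - q \<in> I"
    using add[of p "- q"] uminus[of q] by simp
  show "(\<And>i. i \<in> A \<Longrightarrow> f i \<in> I) \<Longrightarrow> sum f A \<in> I"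
    by (induction A rule: infinite_finite_induct) (simp_all add: zero add)
qed

definition hom_part :: "nat \<Rightarrow> 'v mpoly \<Rightarrow> 'v mpoly" where
  "hom_part k F = (\<Sum>\<mu> | \<mu> \<in> keys F \<and> mdeg \<mu> = k. single \<mu> (lookup F \<mu>))"

lemma keys_hom_part: "keys (hom_part k F) \<subseteq> {\<mu> \<in> keys F. mdeg \<mu> = k}"
  unfolding hom_part_def using keys_sum[of "\<lambda>\<mu>. single \<mu> (lookup F \<mu>)" "{\<mu>. \<mu> \<in> keys F \<and> mdeg \<mu> = k}"]
  by (auto split: if_splits)

lemma homogeneous_hom_part: "homogeneous (hom_part k F)"
  using keys_hom_part[of k F] by (auto simp: homogeneous_def)

lemma hom_part_mpolys_in: "F \<in> mpolys_in V \<Longrightarrow> hom_part k F \<in> mpolys_in V"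
  using keys_hom_part[of k F] by (auto simp: mpolys_in_def)

lemma sum_hom_part: "F = (\<Sum>k\<in>mdeg ` keys F. hom_part k F)"
proof -
  have "F = (\<Sum>\<mu>\<in>keys F. single \<mu> (lookup F \<mu>))"
    by (simp flip: poly_mapping_sum_single)
  also have "\<dots> = (\<Sum>k\<in>mdeg ` keys F. hom_part k F)"
    unfolding hom_part_def by (rule sum.group[symmetric]) auto
  finally show ?thesis .
qed

lemma mval_scale: "mval (\<lambda>v. t * b v) \<mu> = t ^ mdeg \<mu> * mval b \<mu>"
  by (simp add: mval_def mdeg_def power_mult_distrib prod.distrib power_sum)

lemma eval_hom_part_scale:
  "eval_mpoly (hom_part k F) (\<lambda>v. t * b v) = t ^ k * eval_mpoly (hom_part k F) b"
  by (simp add: hom_part_def eval_sum eval_single mval_scale sum_distrib_left mult_ac)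

text \<open>Along the line through 0 and b, F is a univariate polynomial in t whose coefficients are
  the values at b of the homogeneous parts of F.\<close>

lemma eval_hom_part_eq_0:
  assumes "\<And>t. t \<noteq> 0 \<Longrightarrow> eval_mpoly F (\<lambda>v. t * b v) = 0"
  shows "eval_mpoly (hom_part k F) b = 0"
proof (cases "k \<in> mdeg ` keys F")
  case True
  define p where "p = (\<Sum>k\<in>mdeg ` keys F. monom (eval_mpoly (hom_part k F) b) k)"
  have p: "poly p t = eval_mpoly F (\<lambda>v. t * b v)" for t
  proof -
    have "poly p t = eval_mpoly (\<Sum>k\<in>mdeg ` keys F. hom_part k F) (\<lambda>v. t * b v)"
      by (simp add: p_def poly_sum poly_monom eval_sum eval_hom_part_scale mult.commute)
    then show ?thesis by (simp only: sum_hom_part[symmetric])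
  qed
  \<comment> \<open>The factor \<open>[:0, 1:]\<close> supplies the zero at \<open>t = 0\<close>,
    which the assumption leaves out.\<close>
  have "poly ([:0, 1:] * p) t = 0" for t
    using assms[of t] by (cases "t = 0") (simp_all add: p)
  then have "[:0, 1:] * p = 0"
    using poly_all_0_iff_0 by blast
  then have "coeff p k = 0" by simp
  then show ?thesis
    using True by (simp add: p_def coeff_sum)
next
  case False
  then have "{\<mu>. \<mu> \<in> keys F \<and> mdeg \<mu> = k} = {}" by auto
  then have "hom_part k F = 0" by (simp only: hom_part_def sum.empty)
  then show ?thesis by simp
qed

text \<open>Testing all nonzero multiples of T makes the condition meaningful for inhomogeneous F
  and stable under taking homogeneous parts.\<close>

definition cone_ideal :: "nat \<Rightarrow> nat \<Rightarrow> nat \<Rightarrow> nat \<Rightarrow> pade_var mpoly set" where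
  "cone_ideal n d e m = {F \<in> mpolys_in (c_vars n m).
     \<forall>T\<in>taylor_polys n d e m. \<forall>a. a \<noteq> 0 \<longrightarrow> eval_at_coeffs F (Const a * T) = 0}"

lemma ideal_cone_ideal: "ideal (cone_ideal n d e m) (mpoly_ring (c_vars n m))"
  by (rule ideal_mpolyI)
    (auto simp: cone_ideal_def mpolys_in_add mult_mpolys_in eval_at_coeffs_def eval_add eval_mult)

lemma hom_part_cone_ideal:
  assumes F: "F \<in> cone_ideal n d e m"
  shows "hom_part k F \<in> cone_ideal n d e m"
proof -
  have "eval_at_coeffs (hom_part k F) (Const a * T) = 0"
    if T: "T \<in> taylor_polys n d e m" and a: "a \<noteq> 0" for T a
    unfolding eval_at_coeffs_def
  proof (rule eval_hom_part_eq_0)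
    fix t :: complex assume t: "t \<noteq> 0"
    then have "eval_at_coeffs F (Const (t * a) * T) = 0"
      using F T a by (simp add: cone_ideal_def)
    moreover have "(\<lambda>v. t * (case v of c_var \<gamma> \<Rightarrow> lookup (Const a * T) \<gamma> | q_var _ \<Rightarrow> 0)) =
        (\<lambda>v. case v of c_var \<gamma> \<Rightarrow> lookup (Const (t * a) * T) \<gamma> | q_var _ \<Rightarrow> 0)"
      by (auto simp: lookup_Const_mult split: pade_var.split)
    ultimately show "eval_mpoly F
        (\<lambda>v. t * (case v of c_var \<gamma> \<Rightarrow> lookup (Const a * T) \<gamma> | q_var _ \<Rightarrow> 0)) = 0"
      by (simp add: eval_at_coeffs_def)
  qed
  with F show ?thesis
    by (simp add: cone_ideal_def hom_part_mpolys_in)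
qed

lemma cone_ideal_generated:
  "cone_ideal n d e m = Idl\<^bsub>mpoly_ring (c_vars n m)\<^esub> {F \<in> cone_ideal n d e m. homogeneous F}"
    (is "?K = Idl\<^bsub>?R\<^esub> ?H")
proof
  interpret ring ?R by (rule mpoly_ring_ring)
  have H: "?H \<subseteq> carrier ?R"
    by (auto simp: cone_ideal_def)
  show "Idl\<^bsub>?R\<^esub> ?H \<subseteq> ?K"
    by (rule genideal_minimal[OF ideal_cone_ideal]) auto
  show "?K \<subseteq> Idl\<^bsub>?R\<^esub> ?H"
  proof
    fix F assume F: "F \<in> ?K"
    have "hom_part k F \<in> Idl\<^bsub>?R\<^esub> ?H" for k
      using genideal_self[OF H] hom_part_cone_ideal[OF F] homogeneous_hom_part[of k F] by blast
    then have "(\<Sum>k\<in>mdeg ` keys F. hom_part k F) \<in> Idl\<^bsub>?R\<^esub> ?H"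
      by (rule ideal_mpolyD(7)[OF genideal_ideal[OF H]])
    then show "F \<in> Idl\<^bsub>?R\<^esub> ?H"
      by (simp only: sum_hom_part[symmetric])
  qed
qed

text \<open>Zariski closure adds no condition: the zero set of one homogeneous F in the cone ideal
  is closed and contains the Taylor points, hence also their hull. So both ideals have the same
  homogeneous elements as generators.\<close>

lemma taylor_ideal_eq_cone_ideal: "taylor_ideal n d e m = cone_ideal n d e m"
proof -
  let ?P = "proj_point ` taylor_polys n d e m"
  have "(\<forall>p\<in>taylor_variety n d e m. vanishes_at F p) \<longleftrightarrow> F \<in> cone_ideal n d e m"
    if F: "F \<in> mpolys_in (c_vars n m)" "homogeneous F" for F
  proof
    assume "\<forall>p\<in>taylor_variety n d e m. vanishes_at F p"
    then have "\<forall>p\<in>?P. vanishes_at F p"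
      unfolding taylor_variety_def by (meson hull_inc)
    then show "F \<in> cone_ideal n d e m"
      using F by (auto simp: cone_ideal_def vanishes_at_def proj_point_def)
  next
    assume K: "F \<in> cone_ideal n d e m"
    let ?Z = "{p \<in> proj_space n m. \<forall>G\<in>{F}. vanishes_at G p}"
    have "zariski_closed n m ?Z"
      unfolding zariski_closed_def using F by (intro exI[of _ "{F}"]) simp
    moreover have "?P \<subseteq> ?Z"
    proof (rule image_subsetI)
      fix T assume T: "T \<in> taylor_polys n d e m"
      then have "T \<in> mpolys_in {..<n}" "degree_le m T"
        using keys_subset_monoms_between_iff[of T n m] by (simp_all add: taylor_polys_iff)
      moreover have "T \<noteq> 0"
        using lookup_taylor_poly_0[OF T] by auto
      ultimately have "proj_point T \<in> proj_space n m"
        by (auto simp: proj_space_def)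
      moreover have "vanishes_at F (proj_point T)"
        using K T by (auto simp: cone_ideal_def vanishes_at_def proj_point_def)
      ultimately show "proj_point T \<in> ?Z" by simp
    qed
    ultimately have "taylor_variety n d e m \<subseteq> ?Z"
      unfolding taylor_variety_def by (intro hull_minimal)
    then show "\<forall>p\<in>taylor_variety n d e m. vanishes_at F p" by blast
  qed
  then have "{F \<in> mpolys_in (c_vars n m). homogeneous F \<and> (\<forall>p\<in>taylor_variety n d e m. vanishes_at F p)}
      = {F \<in> cone_ideal n d e m. homogeneous F}"
    by (auto simp: cone_ideal_def)
  then show ?thesis
    unfolding taylor_ideal_def vanishing_ideal_def by (simp flip: cone_ideal_generated)
qed

section \<open>Reduction modulo the Pade ideal\<close>

definition pade_gen :: "nat \<Rightarrow> nat \<Rightarrow> nat monom \<Rightarrow> pade_var mpoly" where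
  "pade_gen n e \<alpha> = (\<Sum>\<beta>\<in>monoms_between n 0 e. pade_matrix \<alpha> \<beta> * Var (q_var \<beta>))"

definition pade_point :: "nat mpoly \<Rightarrow> nat mpoly \<Rightarrow> pade_var \<Rightarrow> complex" where
  "pade_point T Q v = (case v of c_var \<gamma> \<Rightarrow> lookup T \<gamma> | q_var \<beta> \<Rightarrow> lookup Q \<beta>)"

text \<open>The variables that survive the elimination of the \<open>c\<^sub>\<gamma>\<close> with \<open>d < |\<gamma>|\<close>.\<close>

definition free_vars :: "nat \<Rightarrow> nat \<Rightarrow> nat \<Rightarrow> nat \<Rightarrow> pade_var set" where
  "free_vars n d e m = c_vars n (min d m) \<union> q_vars n e"

lemma free_vars_subset: "free_vars n d e m \<subseteq> c_vars n m \<union> q_vars n e"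
  by (auto simp: free_vars_def c_vars_def monoms_between_def)

lemma zero_in_monoms_between: "0 \<in> monoms_between n 0 b"
  by (simp add: monoms_between_def monoms_in_def)

lemma mdeg_minus:
  assumes "\<forall>i. lookup \<beta> i \<le> lookup \<alpha> i"
  shows "mdeg \<alpha> = mdeg \<beta> + mdeg (\<alpha> - \<beta>)"
proof -
  have "\<beta> + (\<alpha> - \<beta>) = \<alpha>"
    using assms by (intro poly_mapping_eqI) (simp add: lookup_add lookup_minus)
  then show ?thesis by (metis mdeg_add)
qed

lemma minus_in_monoms_between:
  assumes "\<alpha> \<in> monoms_between n a b" "\<forall>i. lookup \<beta> i \<le> lookup \<alpha> i"
  shows "\<alpha> - \<beta> \<in> monoms_between n 0 b"
proof -
  have "keys (\<alpha> - \<beta>) \<subseteq> keys \<alpha>"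
    by (auto simp: in_keys_iff lookup_minus)
  with assms mdeg_minus[OF assms(2)] show ?thesis
    by (auto simp: monoms_between_def monoms_in_def)
qed

lemma pade_matrix_mpolys_in:
  "\<alpha> \<in> monoms_between n a m \<Longrightarrow> pade_matrix \<alpha> \<beta> \<in> mpolys_in (c_vars n m)"
  by (auto simp: pade_matrix_def c_vars_def intro!: mpolys_in_Var minus_in_monoms_between)

lemma pade_gen_mpolys_in:
  assumes "\<alpha> \<in> monoms_between n a m"
  shows "pade_gen n e \<alpha> \<in> mpolys_in (c_vars n m \<union> q_vars n e)"
  unfolding pade_gen_def
  by (intro mpolys_in_sum mult_mpolys_in mpolys_in_Var mpolys_in_mono[OF _ pade_matrix_mpolys_in[OF assms]])
    (auto simp: q_vars_def)

lemma pade_ideal_eq: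
  "pade_ideal n d e m = Idl\<^bsub>mpoly_ring (c_vars n m \<union> q_vars n e)\<^esub> (pade_gen n e ` monoms_between n (d + 1) m)"
  unfolding pade_ideal_def pade_ring_def pade_gen_def ..

lemma ideal_pade_ideal: "ideal (pade_ideal n d e m) (mpoly_ring (c_vars n m \<union> q_vars n e))"
  unfolding pade_ideal_eq
  by (intro ring.genideal_ideal[OF mpoly_ring_ring]) (auto intro: pade_gen_mpolys_in)

lemma pade_gen_in_pade_ideal:
  assumes "\<alpha> \<in> monoms_between n (d + 1) m"
  shows "pade_gen n e \<alpha> \<in> pade_ideal n d e m"
proof -
  have "pade_gen n e ` monoms_between n (d + 1) m \<subseteq> pade_ideal n d e m"
    unfolding pade_ideal_eq
    by (intro ring.genideal_self[OF mpoly_ring_ring]) (auto intro: pade_gen_mpolys_in)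
  with assms show ?thesis by blast
qed

text \<open>The Pade matrix represents multiplication of Q by T. Hence a pair (T, Q) is a zero of
  the Pade ideal when Q T has no terms in degrees d + 1 to m.\<close>

lemma eval_pade_gen:
  assumes "keys Q \<subseteq> monoms_between n 0 e"
  shows "eval_mpoly (pade_gen n e \<alpha>) (pade_point T Q) = lookup (Q * T) \<alpha>"
  unfolding pade_gen_def eval_sum lookup_mult_sum[OF finite_monoms_between assms]
  by (rule sum.cong) (auto simp: eval_mult pade_matrix_def pade_point_def)

lemma pade_ideal_vanishes:
  assumes F: "F \<in> pade_ideal n d e m" and Q: "keys Q \<subseteq> monoms_between n 0 e"
    and QT: "\<And>\<alpha>. \<alpha> \<in> monoms_between n (d + 1) m \<Longrightarrow> lookup (Q * T) \<alpha> = 0"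
  shows "eval_mpoly F (pade_point T Q) = 0"
proof -
  let ?V = "c_vars n m \<union> q_vars n e"
  let ?I = "{F \<in> mpolys_in ?V. eval_mpoly F (pade_point T Q) = 0}"
  have "ideal ?I (mpoly_ring ?V)"
    by (rule ideal_mpolyI) (auto simp: mpolys_in_add mult_mpolys_in eval_add eval_mult)
  moreover have "pade_gen n e ` monoms_between n (d + 1) m \<subseteq> ?I"
    using QT by (auto simp: eval_pade_gen[OF Q] intro: pade_gen_mpolys_in)
  ultimately have "pade_ideal n d e m \<subseteq> ?I"
    unfolding pade_ideal_eq by (rule ring.genideal_minimal[OF mpoly_ring_ring])
  with F show ?thesis by blast
qed

lemma eval_pade_point:
  assumes "F \<in> mpolys_in (c_vars n m)"
  shows "eval_mpoly F (pade_point T Q) = eval_at_coeffs F T"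
  unfolding eval_at_coeffs_def using assms
  by (rule eval_cong) (auto simp: c_vars_def pade_point_def)

text \<open>Up to degree m the product Q T agrees with P, which has no terms above degree d.\<close>

lemma lookup_product_eq_0:
  fixes P Q T :: "nat mpoly"
  assumes "keys P \<subseteq> monoms_between n 0 d" "order_ge (Suc m) (P - Q * T)"
    "\<alpha> \<in> monoms_between n (d + 1) m"
  shows "lookup (Q * T) \<alpha> = 0"
proof -
  have "\<alpha> \<notin> monoms_between n 0 d" "mdeg \<alpha> < Suc m"
    using assms(3) by (auto simp: monoms_between_def)
  then have "lookup P \<alpha> = 0" "lookup (P - Q * T) \<alpha> = 0"
    using assms(1,2) by (auto simp: in_keys_iff order_ge_lookup)
  then show ?thesis by (simp add: lookup_minus)
qed

text \<open>If T is the Taylor polynomial of P/Q, then (a T, Q) is a zero of the Pade ideal with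
  \<open>q_var 0\<close> equal to 1, so the power of that variable drops out. This is one inclusion
  of the theorem.\<close>

lemma cone_idealI_saturation:
  assumes g: "g \<in> mpolys_in (c_vars n m)" and J: "Var (q_var 0) ^ k * g \<in> pade_ideal n d e m"
  shows "g \<in> cone_ideal n d e m"
  unfolding cone_ideal_def
proof (intro CollectI conjI ballI allI impI g)
  fix T :: "nat mpoly" and a :: complex
  assume "T \<in> taylor_polys n d e m"
  then obtain P Q where PQ: "keys P \<subseteq> monoms_between n 0 d" "keys Q \<subseteq> monoms_between n 0 e"
    "lookup Q 0 = 1" "order_ge (Suc m) (P - Q * T)"
    unfolding taylor_polys_iff by blast
  have "lookup (Q * (Const a * T)) \<alpha> = 0" if "\<alpha> \<in> monoms_between n (d + 1) m" for \<alpha>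
    using lookup_product_eq_0[OF PQ(1,4) that]
    by (simp only: mult.left_commute[of Q] lookup_Const_mult mult_zero_right)
  then have "eval_mpoly (Var (q_var 0) ^ k * g) (pade_point (Const a * T) Q) = 0"
    by (rule pade_ideal_vanishes[OF J PQ(2)])
  then show "eval_at_coeffs g (Const a * T) = 0"
    using PQ(3) by (simp add: eval_mult eval_power eval_pade_point[OF g] pade_point_def[of _ _ "q_var 0"])
qed

text \<open>In the localization at \<open>q_var 0\<close>, modulo the Pade ideal, F equals the
  fraction of G by the k-th power of that variable. Stating this with cleared denominators avoids
  constructing the localization.\<close>

definition reduces_to ::
    "nat \<Rightarrow> nat \<Rightarrow> nat \<Rightarrow> nat \<Rightarrow> pade_var mpoly \<Rightarrow> nat \<Rightarrow> pade_var mpoly \<Rightarrow> bool" where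
  "reduces_to n d e m F k G \<longleftrightarrow>
    G \<in> mpolys_in (free_vars n d e m) \<and> Var (q_var 0) ^ k * F - G \<in> pade_ideal n d e m"

section \<open>Existence of reductions to the free variables\<close>

context
  fixes n d e m :: nat
begin

abbreviation (input) "J \<equiv> pade_ideal n d e m"
abbreviation (input) "V \<equiv> c_vars n m \<union> q_vars n e"
abbreviation (input) "W \<equiv> free_vars n d e m"
abbreviation (input) "q0 \<equiv> Var (q_var 0) :: pade_var mpoly"

lemma q0_pow_mpolys_in: "q0 ^ k \<in> mpolys_in W" "q0 ^ k \<in> mpolys_in V"
  using zero_in_monoms_between[of n e]
  by (auto intro!: mpolys_in_power mpolys_in_Var simp: free_vars_def q_vars_def)

lemma free_mpolys_in: "G \<in> mpolys_in W \<Longrightarrow> G \<in> mpolys_in V"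
  using free_vars_subset by (rule mpolys_in_mono)

lemma reduces_to_free: "F \<in> mpolys_in W \<Longrightarrow> reduces_to n d e m F 0 F"
  using ideal_mpolyD(2)[OF ideal_pade_ideal] by (simp add: reduces_to_def)

text \<open>Fractions are added over the common denominator \<open>q0 ^ (k + l)\<close>.\<close>

lemma reduces_to_add:
  assumes F: "reduces_to n d e m F k G" and F': "reduces_to n d e m F' l G'"
  shows "reduces_to n d e m (F + F') (k + l) (q0 ^ l * G + q0 ^ k * G')"
proof -
  have "q0 ^ l * (q0 ^ k * F - G) + q0 ^ k * (q0 ^ l * F' - G') \<in> J"
    using F F' unfolding reduces_to_def
    by (intro ideal_mpolyD(3,4)[OF ideal_pade_ideal] q0_pow_mpolys_in) simp_all
  moreover have "q0 ^ l * (q0 ^ k * F - G) + q0 ^ k * (q0 ^ l * F' - G') =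
      q0 ^ (k + l) * (F + F') - (q0 ^ l * G + q0 ^ k * G')"
    by (simp add: power_add algebra_simps)
  ultimately show ?thesis
    using F F' unfolding reduces_to_def
    by (auto intro!: mpolys_in_add mult_mpolys_in q0_pow_mpolys_in)
qed

lemma reduces_to_mult:
  assumes F: "reduces_to n d e m F k G" and F': "reduces_to n d e m F' l G'" "F' \<in> mpolys_in V"
  shows "reduces_to n d e m (F * F') (k + l) (G * G')"
proof -
  \<comment> \<open>The sum telescopes: the mixed term \<open>q0 ^ l * F' * G\<close>
    cancels.\<close>
  have "(q0 ^ l * F') * (q0 ^ k * F - G) + G * (q0 ^ l * F' - G') \<in> J"
    using F F' mult_mpolys_in[OF q0_pow_mpolys_in(2)] unfolding reduces_to_def
    by (intro ideal_mpolyD(3,4)[OF ideal_pade_ideal]) (simp_all add: free_mpolys_in)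
  moreover have "(q0 ^ l * F') * (q0 ^ k * F - G) + G * (q0 ^ l * F' - G') =
      q0 ^ (k + l) * (F * F') - G * G'"
    by (simp add: power_add algebra_simps)
  ultimately show ?thesis
    using F F' unfolding reduces_to_def by (auto intro!: mult_mpolys_in)
qed

lemma reduces_to_divide:
  assumes "reduces_to n d e m F k G" "q0 * F' - F \<in> J"
  shows "reduces_to n d e m F' (Suc k) G"
proof -
  have "(q0 ^ k * F - G) + q0 ^ k * (q0 * F' - F) \<in> J"
    using assms unfolding reduces_to_def
    by (intro ideal_mpolyD(3,4)[OF ideal_pade_ideal] q0_pow_mpolys_in) simp_all
  moreover have "(q0 ^ k * F - G) + q0 ^ k * (q0 * F' - F) = q0 ^ Suc k * F' - G"
    by (simp add: algebra_simps)
  ultimately show ?thesis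
    using assms unfolding reduces_to_def by simp
qed

lemma reduces_to_sum:
  assumes "finite A" "\<And>i. i \<in> A \<Longrightarrow> \<exists>k G. reduces_to n d e m (f i) k G"
  shows "\<exists>k G. reduces_to n d e m (sum f A) k G"
  using assms
proof (induction A rule: finite_induct)
  case empty
  show ?case using reduces_to_free[of 0] by auto
next
  case (insert i A)
  then obtain k G l G' where "reduces_to n d e m (f i) k G" "reduces_to n d e m (sum f A) l G'"
    by (meson insertI1 insertI2)
  from reduces_to_add[OF this] insert.hyps show ?case by auto
qed

text \<open>The generator in row \<open>\<alpha>\<close> expresses \<open>q\<^sub>0 c\<^sub>\<alpha>\<close> through the \<open>c\<^sub>\<gamma>\<close> of lower degree.\<close>

lemma reduces_to_c_var:
  assumes "\<alpha> \<in> monoms_between n 0 m"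
  shows "\<exists>k G. reduces_to n d e m (Var (c_var \<alpha>)) k G"
  using assms
proof (induction "mdeg \<alpha>" arbitrary: \<alpha> rule: less_induct)
  case less
  show ?case
  proof (cases "mdeg \<alpha> \<le> d")
    case True
    then have "Var (c_var \<alpha>) \<in> mpolys_in W"
      using less.prems by (auto intro!: mpolys_in_Var simp: free_vars_def c_vars_def monoms_between_def)
    then show ?thesis using reduces_to_free by blast
  next
    case False
    let ?B = "monoms_between n 0 e"
    let ?t = "\<lambda>\<beta>. pade_matrix \<alpha> \<beta> * Var (q_var \<beta>)"
    have "\<exists>k G. reduces_to n d e m (?t \<beta>) k G" if \<beta>: "\<beta> \<in> ?B - {0}" for \<beta>
    proof (cases "\<forall>i. lookup \<beta> i \<le> lookup \<alpha> i")
      case True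
      have "mdeg \<beta> \<noteq> 0" using \<beta> by simp
      with mdeg_minus[OF True] have "mdeg (\<alpha> - \<beta>) < mdeg \<alpha>" by linarith
      then obtain k G where "reduces_to n d e m (Var (c_var (\<alpha> - \<beta>))) k G"
        using less.hyps minus_in_monoms_between[OF less.prems True] by blast
      moreover have "Var (q_var \<beta>) \<in> mpolys_in W"
        using \<beta> by (auto intro!: mpolys_in_Var simp: free_vars_def q_vars_def)
      ultimately have "reduces_to n d e m (Var (c_var (\<alpha> - \<beta>)) * Var (q_var \<beta>)) (k + 0) (G * Var (q_var \<beta>))"
        by (intro reduces_to_mult reduces_to_free free_mpolys_in)
      moreover have "?t \<beta> = Var (c_var (\<alpha> - \<beta>)) * Var (q_var \<beta>)"
        using True by (simp only: pade_matrix_def if_True simp_thms)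
      ultimately show ?thesis by metis
    next
      case False
      then have "?t \<beta> = 0" by (simp only: pade_matrix_def if_False mult_zero_left)
      then show ?thesis using reduces_to_free[of 0] by auto
    qed
    then obtain k G where S: "reduces_to n d e m (sum ?t (?B - {0})) k G"
      using reduces_to_sum[of "?B - {0}" ?t] finite_monoms_between by auto
    let ?S = "sum ?t (?B - {0})"
    have "pade_gen n e \<alpha> \<in> J"
      using less.prems False by (intro pade_gen_in_pade_ideal) (simp add: monoms_between_def)
    moreover have "pade_gen n e \<alpha> = q0 * Var (c_var \<alpha>) + ?S"
      unfolding pade_gen_def sum.remove[OF finite_monoms_between zero_in_monoms_between[of n e]]
      by (simp add: pade_matrix_def mult.commute)
    \<comment> \<open>Negation is written as multiplication by a constant, so that
      \<open>reduces_to_mult\<close> applies to it.\<close>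
    moreover have "Const (- 1) * ?S = - ?S"
      by (rule poly_mapping_eqI) (simp only: lookup_Const_mult lookup_uminus mult_minus1)
    ultimately have J: "q0 * Var (c_var \<alpha>) - Const (- 1) * ?S \<in> J"
      by simp
    have "reduces_to n d e m (?S * Const (- 1)) (k + 0) (G * Const (- 1))"
      by (intro reduces_to_mult[OF S reduces_to_free]) simp_all
    then have "reduces_to n d e m (Const (- 1) * ?S) (k + 0) (G * Const (- 1))"
      by (simp only: mult.commute[of ?S])
    from reduces_to_divide[OF this J] show ?thesis by blast
  qed
qed

lemma exists_reduces_to:
  assumes "F \<in> mpolys_in (c_vars n m)"
  shows "\<exists>k G. reduces_to n d e m F k G"
proof -
  \<comment> \<open>Membership in the large ring is carried through the induction because
    \<open>reduces_to_mult\<close> demands it of its second factor.\<close>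
  have "F \<in> mpolys_in V \<and> (\<exists>k G. reduces_to n d e m F k G)"
    using assms
  proof (induction F rule: mpolys_in_induct)
    case (Const c)
    show ?case using reduces_to_free[of "Const c"] by auto
  next
    case (Var v)
    then show ?case using reduces_to_c_var
      by (auto simp: c_vars_def intro!: mpolys_in_Var)
  next
    case (add F F')
    then obtain k G l G' where "reduces_to n d e m F k G" "reduces_to n d e m F' l G'" by meson
    from reduces_to_add[OF this] add show ?case by (auto intro: mpolys_in_add)
  next
    case (mult F F')
    then obtain k G l G' where "reduces_to n d e m F k G" "reduces_to n d e m F' l G'" by meson
    from reduces_to_mult[OF this] mult show ?case by (auto intro: mult_mpolys_in)
  qed
  then show ?thesis by blast
qed

text \<open>On the torus the free coordinates can be prescribed: \<open>q\<close> gives \<open>Q\<close>, the \<open>c\<^sub>\<gamma>\<close> with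
  \<open>|\<gamma>| \<le> d\<close> give the numerator \<open>P\<close>, and the remaining \<open>c\<^sub>\<gamma>\<close> are read off \<open>P / Q\<close>.\<close>

lemma exists_taylor_point:
  assumes a: "\<forall>v. a v \<noteq> 0"
  shows "\<exists>T Q. T \<in> taylor_polys n d e m \<and> keys Q \<subseteq> monoms_between n 0 e \<and>
    (\<forall>\<alpha>\<in>monoms_between n (d + 1) m. lookup (Q * T) \<alpha> = 0) \<and>
    (\<forall>v\<in>W. pade_point (Const (a (c_var 0)) * T) (Const (a (q_var 0)) * Q) v = a v)"
proof -
  \<comment> \<open>The divisions normalize the constant terms of Q and C to 1, as required for
    Taylor polynomials. The scalars in the last conjunct of the claim undo them.\<close>
  define Q where "Q = mpoly_of n e (\<lambda>\<beta>. a (q_var \<beta>) / a (q_var 0))"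
  define C where "C = mpoly_of n (min d m) (\<lambda>\<gamma>. a (c_var \<gamma>) / a (c_var 0))"
  define P where "P = mpoly_of n d (lookup (Q * C))"
  have in_mpolys: "Q \<in> mpolys_in {..<n}" "C \<in> mpolys_in {..<n}" "P \<in> mpolys_in {..<n}"
    using keys_mpoly_of keys_subset_monoms_between_iff unfolding Q_def C_def P_def by blast+
  have Q0: "lookup Q 0 = 1" and C0: "lookup C 0 = 1"
    using a by (simp_all add: Q_def C_def lookup_mpoly_of zero_in_monoms_between)
  have "lookup (Q * C) 0 = 1"
    using eval_mult[of Q C "\<lambda>_. 0"] by (simp add: eval_at_zero Q0 C0)
  then have P0: "lookup P 0 = 1"
    by (simp add: P_def lookup_mpoly_of zero_in_monoms_between)
  obtain T where T: "keys T \<subseteq> monoms_between n 0 m" "order_ge (Suc m) (P - Q * T)"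
    using exists_series_quotient[OF in_mpolys(3,1) Q0] by blast
  have keys: "keys P \<subseteq> monoms_between n 0 d" "keys Q \<subseteq> monoms_between n 0 e"
    by (simp_all add: P_def Q_def keys_mpoly_of)
  \<comment> \<open>Q C and P agree up to degree d, and P and Q T agree up to degree m. Cancelling Q
    then shows that T has the prescribed coefficients of C up to the smaller of the two
    degrees.\<close>
  have "order_ge (Suc (min d m)) (Q * (C - T))"
  proof -
    have "order_ge (Suc d) (Q * C - P)"
      unfolding P_def by (intro order_ge_truncate mult_mpolys_in in_mpolys)
    then have "order_ge (Suc (min d m)) ((Q * C - P) + (P - Q * T))"
      by (intro order_ge_add order_ge_mono[OF T(2)]) (auto elim: order_ge_mono)
    then show ?thesis by (simp add: algebra_simps)
  qed
  then have TC: "order_ge (Suc (min d m)) (C - T)"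
    using Q0 by (rule order_ge_cancel)
  have T_eq: "lookup T \<gamma> = a (c_var \<gamma>) / a (c_var 0)" if "\<gamma> \<in> monoms_between n 0 (min d m)" for \<gamma>
  proof -
    have "mdeg \<gamma> < Suc (min d m)" using that by (simp add: monoms_between_def less_Suc_eq_le)
    then have "lookup (C - T) \<gamma> = 0" using TC unfolding order_ge_lookup by blast
    then show ?thesis using that by (simp add: lookup_minus C_def lookup_mpoly_of)
  qed
  have "T \<in> taylor_polys n d e m"
    unfolding taylor_polys_iff using T keys P0 Q0 by blast
  moreover have "\<forall>v\<in>W. pade_point (Const (a (c_var 0)) * T) (Const (a (q_var 0)) * Q) v = a v"
    using a by (auto simp: free_vars_def c_vars_def q_vars_def pade_point_def lookup_Const_mult T_eq
        Q_def lookup_mpoly_of)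
  ultimately show ?thesis
    using keys(2) lookup_product_eq_0[OF keys(1) T(2)] by blast
qed

text \<open>Any torus point has the same free coordinates as some zero of the Pade ideal lying over
  a multiple of a Taylor polynomial. If F vanishes there, so does G, and G sees only the free
  coordinates, so it vanishes on the whole torus. The converse is the saturation argument.\<close>

lemma cone_ideal_iff_reduces_to_0:
  assumes F: "F \<in> mpolys_in (c_vars n m)" and red: "reduces_to n d e m F k G"
  shows "F \<in> cone_ideal n d e m \<longleftrightarrow> G = 0"
proof
  assume "G = 0"
  with red show "F \<in> cone_ideal n d e m"
    by (intro cone_idealI_saturation[OF F]) (simp add: reduces_to_def)
next
  assume K: "F \<in> cone_ideal n d e m"
  show "G = 0"
  proof (rule mpoly_eq_0I)
    fix a :: "pade_var \<Rightarrow> complex" assume a: "\<forall>v. a v \<noteq> 0"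
    obtain T Q where T: "T \<in> taylor_polys n d e m" and Q: "keys Q \<subseteq> monoms_between n 0 e"
      and QT: "\<And>\<alpha>. \<alpha> \<in> monoms_between n (d + 1) m \<Longrightarrow> lookup (Q * T) \<alpha> = 0"
      and W: "\<And>v. v \<in> W \<Longrightarrow> pade_point (Const (a (c_var 0)) * T) (Const (a (q_var 0)) * Q) v = a v"
      using exists_taylor_point[OF a] by blast
    let ?T = "Const (a (c_var 0)) * T" and ?Q = "Const (a (q_var 0)) * Q"
    have "?Q * ?T = Const (a (q_var 0)) * (Const (a (c_var 0)) * (Q * T))"
      by (simp only: mult_ac)
    then have "lookup (?Q * ?T) \<alpha> = 0" if "\<alpha> \<in> monoms_between n (d + 1) m" for \<alpha>
      using QT[OF that] by (simp only: lookup_Const_mult mult_zero_right)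
    then have "eval_mpoly (q0 ^ k * F - G) (pade_point ?T ?Q) = 0"
      using red keys_Const_mult[of "a (q_var 0)" Q] Q unfolding reduces_to_def
      by (intro pade_ideal_vanishes) auto
    moreover have "eval_mpoly F (pade_point ?T ?Q) = 0"
      using K T a by (simp add: eval_pade_point[OF F] cone_ideal_def)
    ultimately have "eval_mpoly G (pade_point ?T ?Q) = 0"
      by (simp add: eval_diff eval_mult)
    moreover have "eval_mpoly G (pade_point ?T ?Q) = eval_mpoly G a"
      using red W unfolding reduces_to_def by (blast intro: eval_cong)
    ultimately show "eval_mpoly G a = 0" by simp
  qed
qed

section \<open>The saturation and primality\<close>

lemma saturation_pade_ideal:
  "saturation (pade_ring n e m) J q0 \<inter> carrier (mpoly_ring (c_vars n m)) = cone_ideal n d e m"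
proof -
  have "g \<in> saturation (pade_ring n e m) J q0 \<longleftrightarrow> g \<in> cone_ideal n d e m"
    if g: "g \<in> mpolys_in (c_vars n m)" for g
  proof -
    have "g \<in> mpolys_in V"
      using g by (rule mpolys_in_mono[rotated]) simp
    then have sat: "g \<in> saturation (pade_ring n e m) J q0 \<longleftrightarrow> (\<exists>k. q0 ^ k * g \<in> J)"
      by (simp add: saturation_def pade_ring_def mpoly_ring_pow)
    obtain k G where red: "reduces_to n d e m g k G"
      using exists_reduces_to[OF g] by blast
    show ?thesis
      using cone_ideal_iff_reduces_to_0[OF g red] cone_idealI_saturation[OF g] red
      unfolding sat reduces_to_def by auto
  qed
  then show ?thesis
    by (auto simp: cone_ideal_def)
qed

lemma primeideal_cone_ideal: "primeideal (cone_ideal n d e m) (mpoly_ring (c_vars n m))"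
proof (rule primeidealI[OF ideal_cone_ideal mpoly_ring_cring])
  \<comment> \<open>Properness needs at least one Taylor polynomial, at which the constant 1 does
    not vanish. The all-ones point supplies one.\<close>
  obtain T where "T \<in> taylor_polys n d e m"
    using exists_taylor_point[of "\<lambda>_. 1"] by auto
  then have "1 \<notin> cone_ideal n d e m"
    by (auto simp: cone_ideal_def eval_at_coeffs_def intro: exI[of _ 1])
  then show "carrier (mpoly_ring (c_vars n m)) \<noteq> cone_ideal n d e m"
    using mpolys_in_one by auto
next
  fix F F' assume "F \<in> carrier (mpoly_ring (c_vars n m))" "F' \<in> carrier (mpoly_ring (c_vars n m))"
    and prod: "F \<otimes>\<^bsub>mpoly_ring (c_vars n m)\<^esub> F' \<in> cone_ideal n d e m"
  then have F: "F \<in> mpolys_in (c_vars n m)" and F': "F' \<in> mpolys_in (c_vars n m)" by simp_all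
  obtain k G l G' where red: "reduces_to n d e m F k G" "reduces_to n d e m F' l G'"
    using exists_reduces_to F F' by meson
  have "F' \<in> mpolys_in V"
    using F' by (rule mpolys_in_mono[rotated]) simp
  then have "reduces_to n d e m (F * F') (k + l) (G * G')"
    by (rule reduces_to_mult[OF red])
  then have "G * G' = 0"
    using cone_ideal_iff_reduces_to_0[OF mult_mpolys_in[OF F F']] prod by simp
  then have "G = 0 \<or> G' = 0"
    by (rule mpoly_no_zero_divisors)
  then show "F \<in> cone_ideal n d e m \<or> F' \<in> cone_ideal n d e m"
    using cone_ideal_iff_reduces_to_0[OF F red(1)] cone_ideal_iff_reduces_to_0[OF F' red(2)] by blast
qed

end

theorem theorem3p4:
  fixes n d e m :: nat
  assumes "n \<ge> 1"
  shows "saturation (pade_ring n e m) (pade_ideal n d e m) (Var (q_var 0))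
           \<inter> carrier (mpoly_ring (c_vars n m)) = taylor_ideal n d e m
         \<and> homogeneous_ideal (c_vars n m) (taylor_ideal n d e m)
         \<and> primeideal (taylor_ideal n d e m) (mpoly_ring (c_vars n m))"
  unfolding taylor_ideal_eq_cone_ideal homogeneous_ideal_def
  using saturation_pade_ideal ideal_cone_ideal cone_ideal_generated primeideal_cone_ideal by blast

end
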